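(* Let $\mathbb X\subseteq\mathbb R^m$ be a nonempty convex open set, let $T:\mathbb X\to\mathbb R^d$ be Lipschitz continuous and $h:\mathbb X\to(0,+\infty)$ measurable, and put $$\Theta=\Big\{\theta\in\mathbb R^d:\int_{\mathbb X}e^{T(x)\cdot\theta}h(x)\,dx<+\infty\Big\},\qquad M(\theta)=\log\int_{\mathbb X}e^{T(x)\cdot\theta}h(x)\,dx\quad(\theta\in\Theta).$$ Assume the standard regularity conditions: $\Theta$ is a nonempty open set, and the interior of the convex hull of the support of the image under $T$ of the measure $h(x)\,dx$ is nonempty. Let $\pi(d\theta)=e^{-W(\theta)}\,d\theta$ be a probability measure on $\Theta$ with $W\in C^2(\Theta)$. Suppose that for some $\alpha>0$, $\mathrm{Hess}[M+W]\ge\alpha I$ on $\Theta$ in the sense of quadratic forms, and that $$\int_\Theta|\theta|^2\exp\{T(x)\cdot\theta-M(\theta)-W(\theta)\}\,d\theta<+\infty\qquad\text{for every }x\in\mathbb X.$$ Then the posterior distribution $$\pi(d\theta|x)=\frac{e^{T(x)\cdot\theta-M(\theta)}}{\int_\Theta e^{T(x)\cdot\tau-M(\tau)}\,\pi(d\tau)}\,\pi(d\theta)$$ satisfies $$\mathcal W_2(\pi(\cdot|x_1),\pi(\cdot|x_2))\le\frac{\mathrm{Lip}(T)}{\alpha}\,|x_1-x_2|\qquad\forall x_1,x_2\in\mathbb X.$$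
   Context: $\mathcal W_2$ is the 2-Wasserstein distance on probability measures on $\mathbb R^d$ with finite second moment; $\mathrm{Lip}(T)$ is the Lipschitz constant of $T$ for Euclidean norms; $\mathrm{Hess}$ is the Hessian matrix and $I$ the identity matrix. *)

theory Defs
  imports "HOL-Probability.Probability"
begin

subsection \<open>Wasserstein distance\<close>

definition couplings ::
    "'a::topological_space measure \<Rightarrow> 'a measure \<Rightarrow> ('a \<times> 'a) measure set" where
  "couplings \<mu> \<nu> = {\<gamma>. prob_space \<gamma> \<and> sets \<gamma> = sets (borel \<Otimes>\<^sub>M borel) \<and>
     distr \<gamma> borel fst = \<mu> \<and> distr \<gamma> borel snd = \<nu>}"

definition ennreal_sqrt :: "ennreal \<Rightarrow> ennreal" where
  "ennreal_sqrt c = (if c = \<infinity> then \<infinity> else ennreal (sqrt (enn2real c)))"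

text \<open>
  The distance takes values in \<open>[0, \<infinity>]\<close>, so that no default value is needed: it is finite when both
  measures are Borel probability measures with finite second moment, and it is \<open>\<infinity>\<close> when one of
  the two arguments is not a Borel probability measure, as there are no couplings then.
\<close>

definition wasserstein2 ::
    "'a::{metric_space, second_countable_topology} measure \<Rightarrow> 'a measure \<Rightarrow> ennreal" where
  "wasserstein2 \<mu> \<nu> =
     ennreal_sqrt (INF \<gamma>\<in>couplings \<mu> \<nu>. \<integral>\<^sup>+ (y, z). ennreal ((dist y z)\<^sup>2) \<partial>\<gamma>)"


subsection \<open>Analytic notions\<close>

definition Lip :: "'a::metric_space set \<Rightarrow> ('a \<Rightarrow> 'b::metric_space) \<Rightarrow> real" where
  "Lip S f = Inf {L. L-lipschitz_on S f}"

definition measure_support :: "'a::topological_space measure \<Rightarrow> 'a set" where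
  "measure_support \<mu> = {y. \<forall>U. open U \<and> y \<in> U \<longrightarrow> emeasure \<mu> U > 0}"

text \<open>Intended for open \<open>S\<close>; the values of \<open>f\<close> outside \<open>S\<close> are then irrelevant.\<close>

definition C2_on :: "'a::real_normed_vector set \<Rightarrow> ('a \<Rightarrow> real) \<Rightarrow> bool" where
  "C2_on S f \<longleftrightarrow> (\<exists>(f' :: 'a \<Rightarrow> 'a \<Rightarrow>\<^sub>L real) (f'' :: 'a \<Rightarrow> 'a \<Rightarrow>\<^sub>L 'a \<Rightarrow>\<^sub>L real).
     (\<forall>x\<in>S. (f has_derivative blinfun_apply (f' x)) (at x) \<and>
             (f' has_derivative blinfun_apply (f'' x)) (at x)) \<and>
     continuous_on S f'')"

definition partial_deriv :: "'n::finite \<Rightarrow> (real ^ 'n \<Rightarrow> real) \<Rightarrow> real ^ 'n \<Rightarrow> real" where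
  "partial_deriv i f x = deriv (\<lambda>t. f (x + t *\<^sub>R axis i 1)) 0"

definition hess :: "(real ^ 'n \<Rightarrow> real) \<Rightarrow> real ^ 'n::finite \<Rightarrow> real ^ 'n ^ 'n" where
  "hess f x = (\<chi> i j. partial_deriv i (partial_deriv j f) x)"


subsection \<open>Exponential families\<close>

text \<open>
  In the following, \<open>X\<close> is the sample space, \<open>T\<close> the sufficient statistic and \<open>h\<close> the density of
  the base measure; the values of \<open>T\<close> and \<open>h\<close> outside \<open>X\<close> play no role.
\<close>

definition base_image ::
    "(real ^ 'm) set \<Rightarrow> (real ^ 'm \<Rightarrow> real ^ 'd) \<Rightarrow> (real ^ 'm \<Rightarrow> real) \<Rightarrow> (real ^ 'd) measure" where
  "base_image X T h = distr (density (lebesgue_on X) (\<lambda>x. ennreal (h x))) borel T"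

definition natural_params ::
    "(real ^ 'm) set \<Rightarrow> (real ^ 'm \<Rightarrow> real ^ 'd) \<Rightarrow> (real ^ 'm \<Rightarrow> real) \<Rightarrow> (real ^ 'd) set" where
  "natural_params X T h =
     {\<theta>. (\<integral>\<^sup>+ x. ennreal (exp (T x \<bullet> \<theta>) * h x) \<partial>lebesgue_on X) < \<infinity>}"

definition log_partition ::
    "(real ^ 'm) set \<Rightarrow> (real ^ 'm \<Rightarrow> real ^ 'd) \<Rightarrow> (real ^ 'm \<Rightarrow> real) \<Rightarrow> real ^ 'd \<Rightarrow> real" where
  "log_partition X T h \<theta> = ln (\<integral>x. exp (T x \<bullet> \<theta>) * h x \<partial>lebesgue_on X)"

text \<open>
  Measures on a parameter set \<open>\<Theta>\<close> are represented as Borel measures on the whole space that do not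
  charge the complement of \<open>\<Theta>\<close>.
\<close>

definition prior :: "(real ^ 'd) set \<Rightarrow> (real ^ 'd \<Rightarrow> real) \<Rightarrow> (real ^ 'd) measure" where
  "prior \<Theta> W = density lborel (\<lambda>\<theta>. ennreal (exp (- W \<theta>)) * indicator \<Theta> \<theta>)"

definition posterior ::
    "(real ^ 'd) measure \<Rightarrow> (real ^ 'm \<Rightarrow> real ^ 'd) \<Rightarrow> (real ^ 'd \<Rightarrow> real) \<Rightarrow> real ^ 'm
       \<Rightarrow> (real ^ 'd) measure" where
  "posterior \<pi> T M x = density \<pi> (\<lambda>\<theta>.
     ennreal (exp (T x \<bullet> \<theta> - M \<theta>)) / (\<integral>\<^sup>+ \<tau>. ennreal (exp (T x \<bullet> \<tau> - M \<tau>)) \<partial>\<pi>))"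

end

theory Submission
  imports Defs
begin

text \<open>
  Fix \<open>x1\<close>, \<open>x2\<close> in \<open>X\<close> and put \<open>V \<theta> = M \<theta> + W \<theta> - T x1 \<bullet> \<theta>\<close> and \<open>p = T x2 - T x1\<close>.  The two
  posteriors are the probability measures \<open>\<mu>\<close> and \<open>\<nu>\<close> with densities proportional to \<open>exp (- V)\<close>
  and \<open>exp (- V + p \<bullet> \<theta>)\<close> on the convex set \<open>\<Theta>\<close>, and the bound on the Hessian says that \<open>V\<close> is
  \<open>\<alpha>\<close>-strongly convex there.  Since \<open>norm p\<close> is at most \<open>Lip X T * norm (x1 - x2)\<close>, everything
  rests on \<open>wasserstein2_linear_tilt_le\<close>: tilting such a measure by a linear function \<open>p\<close> moves
  it by at most \<open>norm p / \<alpha>\<close>.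

  The transport is not the optimal one but the triangular (Knothe) coupling of \<open>\<mu>\<close> and \<open>\<nu>\<close>, which
  matches one coordinate after the other by conditional quantiles.  Entropy relative to
  \<open>exp (- V)\<close> is convex along it for the same reason as along the optimal map: \<open>V\<close> is convex, and
  so is minus the logarithm of the determinant on triangular matrices with positive diagonal.
  For smooth maps, comparing the entropy with its derivative at either end of the interpolation
  would give
    \<open>\<alpha> E|y - x|^2 \<le> E (p \<bullet> (y - x))\<close>,
  whose right-hand side is at most \<open>|p|^2 / (2 \<alpha>) + \<alpha>/2 E|y - x|^2\<close>, so that
  \<open>E|y - x|^2 \<le> (|p| / \<alpha>)^2\<close>.

  To avoid any regularity question about the map and any boundary term on \<open>\<Theta>\<close>, this convexity is
  used in integrated form: for probability densities \<open>f\<close>, \<open>g\<close> there is one coupling \<open>\<gamma>\<close> with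
    \<open>\<integral> h ((1 - t) x + t y) / (f x powr (1 - t) * g y powr t) d\<gamma> \<le> \<integral> h\<close>
  for all \<open>t \<in> {0<..<1}\<close> and all measurable \<open>h \<ge> 0\<close>, a Prekopa-Leindler inequality that keeps track
  of the coupling (\<open>exists_prekopa_leindler_coupling\<close>).  In dimension one it follows from the
  inequality between weighted arithmetic and geometric means, and it passes from \<open>n\<close> to \<open>n + 1\<close>
  coordinates by disintegration.  It is applied with \<open>h\<close> proportional to
  \<open>exp (- V + t * (p \<bullet> \<theta>))\<close>; strong convexity of \<open>V\<close> bounds the left-hand side from below, both
  sides agree at \<open>t = 0\<close> and at \<open>t = 1\<close>, and comparing their slopes at these two points gives two
  inequalities whose sum is the displayed one.

  Strong convexity of \<open>V\<close> is read off the Hessian along segments, for which \<open>M\<close> has to be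
  differentiated twice under the integral sign (\<open>twice_differentiable_log_mgf\<close>).
\<close>

section \<open>The Prekopa-Leindler inequality along the quantile coupling\<close>

text \<open>
  An open set of reals is the disjoint union of countably many open intervals, its components, and
  outer regularity passes from open sets to Borel sets.
\<close>

lemma emeasure_le_lborel_of_intervals:
  fixes \<rho> :: "real measure"
  assumes sets: "sets \<rho> = sets borel"
    and le: "\<And>C. open C \<Longrightarrow> connected C \<Longrightarrow> emeasure \<rho> C \<le> emeasure lborel C"
    and A: "A \<in> sets borel"
  shows "emeasure \<rho> A \<le> emeasure lborel A"
proof -
  have openle: "emeasure \<rho> U \<le> emeasure lborel U" if U: "open U" for U :: "real set"
  proof -
    have op: "open C" if "C \<in> components U" for C
      using open_components[OF U that] .
    have cnt: "countable (components U)"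
      using pairwise_disjoint_components[of U]
      by (intro countable_disjoint_open_subsets op) (auto simp: pairwise_def disjnt_def)
    have disj: "disjoint_family_on (\<lambda>C. C) (components U)"
      using pairwise_disjoint_components[of U] by (auto simp: pairwise_def disjoint_family_on_def)
    have "emeasure \<rho> U = emeasure \<rho> (\<Union>C\<in>components U. C)" by simp
    also have "\<dots> = (\<integral>\<^sup>+C. emeasure \<rho> C \<partial>count_space (components U))"
      using op sets by (intro emeasure_UN_countable cnt disj) auto
    also have "\<dots> \<le> (\<integral>\<^sup>+C. emeasure lborel C \<partial>count_space (components U))"
      by (intro nn_integral_mono le) (auto dest: op in_components_connected)
    also have "\<dots> = emeasure lborel (\<Union>C\<in>components U. C)"
      using op by (intro emeasure_UN_countable[symmetric] cnt disj) auto
    finally show ?thesis by simp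
  qed
  show ?thesis
  proof (rule ennreal_le_epsilon)
    fix e :: real assume e: "0 < e"
    obtain U where U: "open U" "A \<subseteq> U" "emeasure lborel (U - A) < e"
      using outer_regular_lborel[OF A e] .
    have "emeasure \<rho> A \<le> emeasure \<rho> U"
      using U sets by (intro emeasure_mono) auto
    also have "\<dots> \<le> emeasure lborel U" using openle U by simp
    also have "U = A \<union> (U - A)" using U by auto
    also have "emeasure lborel \<dots> \<le> emeasure lborel A + emeasure lborel (U - A)"
      using U A by (intro emeasure_subadditive) auto
    also have "\<dots> \<le> emeasure lborel A + e"
      using U by (intro add_mono) auto
    finally show "emeasure \<rho> A \<le> emeasure lborel A + ennreal e" .
  qed
qed

lemma nn_integral_mono_emeasure:
  assumes sets: "sets M = sets N"
    and le: "\<And>A. A \<in> sets M \<Longrightarrow> emeasure M A \<le> emeasure N A"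
    and f: "f \<in> borel_measurable M"
  shows "integral\<^sup>N M f \<le> integral\<^sup>N N f"
proof -
  have [measurable_cong]: "sets N = sets M" using sets by simp
  have space: "space N = space M" using sets by (rule sets_eq_imp_space_eq[symmetric])
  show ?thesis using f
  proof (induction rule: borel_measurable_induct)
    case (cong f g)
    have "integral\<^sup>N M f = integral\<^sup>N M g" "integral\<^sup>N N f = integral\<^sup>N N g"
      using cong(3) space by (auto intro!: nn_integral_cong)
    with cong(4) show ?case by (simp only:)
  next
    case (set A)
    with le[of A] show ?case by (simp add: sets[symmetric])
  next
    case (mult u c)
    have [measurable]: "u \<in> borel_measurable N" using mult by simp
    show ?case using mult by (simp add: nn_integral_cmult mult_left_mono)
  next
    case (add u v)
    have [measurable]: "u \<in> borel_measurable N" "v \<in> borel_measurable N"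
      using add by simp_all
    show ?case using add by (simp add: nn_integral_add add_mono)
  next
    case (seq U)
    have [measurable]: "U i \<in> borel_measurable N" for i using seq by simp
    have "(\<integral>\<^sup>+x. (SUP i. U i x) \<partial>M) \<le> (\<integral>\<^sup>+x. (SUP i. U i x) \<partial>N)"
      unfolding nn_integral_monotone_convergence_SUP[OF \<open>incseq U\<close> \<open>\<And>i. U i \<in> borel_measurable M\<close>]
        nn_integral_monotone_convergence_SUP[OF \<open>incseq U\<close> \<open>\<And>i. U i \<in> borel_measurable N\<close>]
      using \<open>\<And>i. integral\<^sup>N M (U i) \<le> integral\<^sup>N N (U i)\<close> by (rule SUP_mono')
    then show ?case by (simp add: image_comp)
  qed
qed

abbreviation unif01 :: "real measure" where
  "unif01 \<equiv> restrict_space lborel {0<..<1}"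

definition quantile :: "real measure \<Rightarrow> real \<Rightarrow> real" where
  "quantile P u = Inf {x. u \<le> cdf P x}"

lemma prob_space_unif01: "prob_space unif01"
  by (auto simp: space_restrict_space emeasure_restrict_space intro!: prob_spaceI)

lemma real_distribution_density:
  fixes f :: "real \<Rightarrow> real"
  assumes "f \<in> borel_measurable borel" "(\<integral>\<^sup>+s. ennreal (f s) \<partial>lborel) = 1"
  shows "real_distribution (density lborel (\<lambda>s. ennreal (f s)))"
  using assms by (auto simp: real_distribution_def real_distribution_axioms_def emeasure_density
      intro!: prob_spaceI)

lemma (in real_distribution)
  shows quantile_le_iff: "0 < u \<Longrightarrow> u < 1 \<Longrightarrow> quantile M u \<le> x \<longleftrightarrow> u \<le> cdf M x"
    and mono_on_quantile: "mono_on {0<..<1} (quantile M)"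
    and measurable_quantile: "quantile M \<in> borel_measurable unif01"
    and distr_quantile: "distr unif01 borel (quantile M) = M"
proof -
  interpret C: cdf_distribution M ..
  have q: "quantile M = C.I" by (auto simp: quantile_def)
  show "0 < u \<Longrightarrow> u < 1 \<Longrightarrow> quantile M u \<le> x \<longleftrightarrow> u \<le> cdf M x"
    using C.pseudoinverse unfolding q by blast
  show "mono_on {0<..<1} (quantile M)" using C.mono_I unfolding q .
  show "quantile M \<in> borel_measurable unif01" using C.measurable_CI unfolding q
    by (simp cong: measurable_cong_sets)
  show "distr unif01 borel (quantile M) = M" using C.distr_I_eq_M unfolding q .
qed

text \<open>
  The quantile function pushes the uniform distribution to the measure with density \<open>f\<close>, so that
  \<open>1 / f\<close> integrates over the levels in \<open>J\<close> to at most the length of an interval that contains their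
  quantiles.  This replaces the formula \<open>1 / f\<close> for the derivative of the quantile function, which
  need not exist for merely measurable \<open>f\<close>.
\<close>

lemma nn_integral_inverse_density_quantile:
  fixes f :: "real \<Rightarrow> real"
  assumes f[measurable]: "f \<in> borel_measurable borel" and f0: "\<And>s. f s \<ge> 0"
    and f1: "(\<integral>\<^sup>+s. ennreal (f s) \<partial>lborel) = 1"
    and J: "\<And>u. u \<in> J \<Longrightarrow> u \<in> {0<..<1} \<Longrightarrow> quantile (density lborel (\<lambda>s. ennreal (f s))) u \<in> {a..b}"
    and ab: "a \<le> b"
  shows "(\<integral>\<^sup>+u. indicator J u * ennreal (1 / f (quantile (density lborel (\<lambda>s. ennreal (f s))) u)) \<partial>unif01)
     \<le> ennreal (b - a)"
proof -
  let ?P = "density lborel (\<lambda>s. ennreal (f s))"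
  interpret real_distribution ?P by (rule real_distribution_density[OF f f1])
  note [measurable] = measurable_quantile
  have "(\<integral>\<^sup>+u. indicator J u * ennreal (1 / f (quantile ?P u)) \<partial>unif01)
      \<le> (\<integral>\<^sup>+u. indicator {a..b} (quantile ?P u) * ennreal (1 / f (quantile ?P u)) \<partial>unif01)"
    using J by (intro nn_integral_mono mult_right_mono) (auto simp: indicator_def space_restrict_space)
  also have "\<dots> = (\<integral>\<^sup>+s. indicator {a..b} s * ennreal (1 / f s) \<partial>distr unif01 borel (quantile ?P))"
    by (subst nn_integral_distr) auto
  also have "\<dots> = (\<integral>\<^sup>+s. ennreal (f s) * (indicator {a..b} s * ennreal (1 / f s)) \<partial>lborel)"
    unfolding distr_quantile by (subst nn_integral_density) auto
  also have "\<dots> \<le> (\<integral>\<^sup>+s. indicator {a..b} s \<partial>lborel)"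
    using f0 by (intro nn_integral_mono) (auto simp: indicator_def simp flip: ennreal_mult)
  also have "\<dots> = ennreal (b - a)" using ab by simp
  finally show ?thesis .
qed

lemma AE_quantile_density_pos:
  fixes f :: "real \<Rightarrow> real"
  assumes f[measurable]: "f \<in> borel_measurable borel"
    and f1: "(\<integral>\<^sup>+s. ennreal (f s) \<partial>lborel) = 1"
  shows "AE u in unif01. f (quantile (density lborel (\<lambda>s. ennreal (f s))) u) > 0"
proof -
  let ?P = "density lborel (\<lambda>s. ennreal (f s))"
  interpret real_distribution ?P by (rule real_distribution_density[OF f f1])
  note [measurable] = measurable_quantile
  have "AE s in distr unif01 borel (quantile ?P). f s > 0"
    unfolding distr_quantile by (subst AE_density) (auto simp: ennreal_eq_0_iff)
  then show ?thesis by (subst (asm) AE_distr_iff) auto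
qed

text \<open>
  Let \<open>z = (1 - t) x + t y\<close> interpolate between the quantile functions \<open>x\<close> and \<open>y\<close> of the two
  densities.  Formally \<open>z' = (1 - t) / f x + t / g y\<close>, so substituting \<open>s = z u\<close> in \<open>\<integral> h\<close> and
  estimating the arithmetic mean \<open>z'\<close> by the geometric mean gives the claim.  The substitution is
  replaced by the statement that \<open>z\<close> pushes the measure with density \<open>w = z'\<close> to a measure \<open>\<rho>\<close>
  dominated by Lebesgue measure, which only has to be tested on intervals.
\<close>

lemma prekopa_leindler_quantile_coupling:
  fixes f g :: "real \<Rightarrow> real" and h :: "real \<Rightarrow> ennreal"
  defines "P \<equiv> density lborel (\<lambda>s. ennreal (f s))" and "Q \<equiv> density lborel (\<lambda>s. ennreal (g s))"
  assumes f[measurable]: "f \<in> borel_measurable borel" and f0: "\<And>s. f s \<ge> 0"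
    and f1: "(\<integral>\<^sup>+s. ennreal (f s) \<partial>lborel) = 1"
    and g[measurable]: "g \<in> borel_measurable borel" and g0: "\<And>s. g s \<ge> 0"
    and g1: "(\<integral>\<^sup>+s. ennreal (g s) \<partial>lborel) = 1"
    and h[measurable]: "h \<in> borel_measurable borel"
    and t: "0 < t" "t < 1"
  shows "(\<integral>\<^sup>+u. h ((1 - t) * quantile P u + t * quantile Q u) *
            ennreal (f (quantile P u) powr (t - 1) * g (quantile Q u) powr (- t)) \<partial>unif01)
         \<le> (\<integral>\<^sup>+s. h s \<partial>lborel)"
proof -
  interpret P: real_distribution P unfolding P_def by (rule real_distribution_density[OF f f1])
  interpret Q: real_distribution Q unfolding Q_def by (rule real_distribution_density[OF g g1])
  note [measurable] = P.measurable_quantile Q.measurable_quantile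
  define x y where "x = quantile P" and "y = quantile Q"
  define z where "z = (\<lambda>u. (1 - t) * x u + t * y u)"
  have [measurable]: "x \<in> borel_measurable unif01" "y \<in> borel_measurable unif01"
    unfolding x_def y_def by measurable
  have [measurable]: "z \<in> borel_measurable unif01" unfolding z_def by measurable
  have xmono: "x u \<le> x v" and ymono: "y u \<le> y v" if "u \<in> {0<..<1}" "v \<in> {0<..<1}" "u \<le> v" for u v
    using P.mono_on_quantile Q.mono_on_quantile that unfolding x_def y_def
    by (auto simp: mono_on_def)
  have zmono: "z u \<le> z v" if "u \<in> {0<..<1}" "v \<in> {0<..<1}" "u \<le> v" for u v
    using xmono[OF that] ymono[OF that] t unfolding z_def by (intro add_mono mult_left_mono) auto
  define w where "w = (\<lambda>u. ennreal (1 - t) * ennreal (1 / f (x u)) + ennreal t * ennreal (1 / g (y u)))"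
  have [measurable]: "w \<in> borel_measurable unif01" unfolding w_def by measurable
  define \<rho> where "\<rho> = distr (density unif01 w) borel z"
  have sets_\<rho>: "sets \<rho> = sets borel" by (simp add: \<rho>_def)
  have interval: "emeasure \<rho> C \<le> emeasure lborel C" if C: "open C" "connected C" for C :: "real set"
  proof (cases "emeasure lborel C = \<infinity>")
    case False
    define L where "L = measure lborel C"
    have eL: "emeasure lborel C = ennreal L"
      using False by (simp add: L_def emeasure_eq_ennreal_measure)
    have diff: "d - c \<le> L" if "c \<in> C" "d \<in> C" for c d
    proof (cases "c \<le> d")
      case True
      have "{c..d} \<subseteq> C" using C that by (simp add: connected_contains_Icc)
      then have "emeasure lborel {c..d} \<le> emeasure lborel C"
        using C by (intro emeasure_mono) auto
      then have "ennreal (d - c) \<le> ennreal L" using True eL by simp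
      then show ?thesis by (simp add: L_def)
    next
      case False
      then have "d - c \<le> 0" by simp
      also have "0 \<le> L" by (simp add: L_def)
      finally show ?thesis .
    qed
    \<comment> \<open>On the levels \<open>J\<close> that \<open>z\<close> sends into \<open>C\<close>, the ranges of \<open>x\<close> and \<open>y\<close> have weighted total length at most that of \<open>C\<close>.\<close>
    define J where "J = {u \<in> {0<..<1}. z u \<in> C}"
    show ?thesis
    proof (cases "J = {}")
      case False
      have "(1 - t) * (x v - x u) + t * (y v' - y u') \<le> L"
        if "u \<in> J" "v \<in> J" "u' \<in> J" "v' \<in> J" for u v u' v'
      proof -
        have 1: "min u u' \<in> J" "max v v' \<in> J" using that by (auto simp: min_def max_def)
        have "(1 - t) * (x v - x u) + t * (y v' - y u') \<le>
          (1 - t) * (x (max v v') - x (min u u')) + t * (y (max v v') - y (min u u'))"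
          using that 1 t
          by (intro add_mono mult_left_mono diff_mono xmono ymono) (auto simp: J_def)
        also have "\<dots> = z (max v v') - z (min u u')" by (simp add: z_def algebra_simps)
        also have "\<dots> \<le> L" using 1 by (intro diff) (auto simp: J_def)
        finally show ?thesis .
      qed
      note key = this
      obtain j where j: "j \<in> J" using False by auto
      define a b c d where "a = Inf (x ` J)" and "b = Sup (x ` J)" and "c = Inf (y ` J)" and "d = Sup (y ` J)"
      have xb: "x v - x u \<le> L / (1 - t)" if "u \<in> J" "v \<in> J" for u v
        using key[OF that j j] t by (simp add: field_simps)
      have yb: "y v - y u \<le> L / t" if "u \<in> J" "v \<in> J" for u v
        using key[OF j j that] t by (simp add: field_simps)
      have xa: "bdd_above (x ` J)" "bdd_below (x ` J)"
        using xb[OF j] xb[OF _ j]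
        by (auto intro!: bdd_aboveI[of _ "x j + L / (1 - t)"] bdd_belowI[of _ "x j - L / (1 - t)"]
            simp: algebra_simps)
      have ya: "bdd_above (y ` J)" "bdd_below (y ` J)"
        using yb[OF j] yb[OF _ j]
        by (auto intro!: bdd_aboveI[of _ "y j + L / t"] bdd_belowI[of _ "y j - L / t"]
            simp: algebra_simps)
      have xin: "x u \<in> {a..b}" and yin: "y u \<in> {c..d}" if "u \<in> J" for u
        using that xa ya by (auto simp: a_def b_def c_def d_def intro: cInf_lower cSup_upper)
      have ab: "a \<le> b" "c \<le> d" using xin[OF j] yin[OF j] by auto
      have sum: "(1 - t) * (b - a) + t * (d - c) \<le> L"
      proof -
        have "b \<le> x u + (L - t * (y v' - y u')) / (1 - t)" if "u \<in> J" "u' \<in> J" "v' \<in> J" for u u' v'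
          unfolding b_def using key[OF that(1) _ that(2,3)] t j
          by (intro cSup_least) (auto simp: field_simps)
        then have "b - (L - t * (y v' - y u')) / (1 - t) \<le> a" if "u' \<in> J" "v' \<in> J" for u' v'
          unfolding a_def using that j by (intro cInf_greatest) (auto simp: algebra_simps)
        then have k2: "(1 - t) * (b - a) + t * (y v' - y u') \<le> L" if "u' \<in> J" "v' \<in> J" for u' v'
        proof -
          have "(1 - t) * (b - a) \<le> (1 - t) * ((L - t * (y v' - y u')) / (1 - t))"
            using that t \<open>\<And>v' u'. \<lbrakk>u' \<in> J; v' \<in> J\<rbrakk> \<Longrightarrow> b - (L - t * (y v' - y u')) / (1 - t) \<le> a\<close>[of u' v']
            by (intro mult_left_mono) auto
          then show ?thesis using t by simp
        qed
        have "d \<le> y u' + (L - (1 - t) * (b - a)) / t" if "u' \<in> J" for u'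
          unfolding d_def using k2[OF that] t j
          by (intro cSup_least) (auto simp: field_simps)
        then have "d - (L - (1 - t) * (b - a)) / t \<le> c"
          unfolding c_def using j by (intro cInf_greatest) (auto simp: algebra_simps)
        then show ?thesis using t by (simp add: field_simps)
      qed
      have Jm[measurable]: "J \<in> sets unif01"
      proof -
        have "z -` C \<inter> space unif01 \<in> sets unif01"
          using C by (intro measurable_sets[of z unif01 borel]) auto
        also have "z -` C \<inter> space unif01 = J" by (auto simp: J_def space_restrict_space)
        finally show ?thesis .
      qed
      have "emeasure \<rho> C = emeasure (density unif01 w) J"
        unfolding \<rho>_def using C
        by (subst emeasure_distr) (auto simp: J_def space_restrict_space intro!: arg_cong2[where f=emeasure])
      also have "\<dots> = (\<integral>\<^sup>+u. w u * indicator J u \<partial>unif01)"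
        by (subst emeasure_density) auto
      also have "\<dots> = (\<integral>\<^sup>+u. ennreal (1 - t) * (indicator J u * ennreal (1 / f (x u)))
            + ennreal t * (indicator J u * ennreal (1 / g (y u))) \<partial>unif01)"
        by (intro nn_integral_cong) (simp add: w_def algebra_simps)
      also have "\<dots> = ennreal (1 - t) * (\<integral>\<^sup>+u. indicator J u * ennreal (1 / f (x u)) \<partial>unif01)
            + ennreal t * (\<integral>\<^sup>+u. indicator J u * ennreal (1 / g (y u)) \<partial>unif01)"
        by (simp add: nn_integral_add nn_integral_cmult)
      also have "\<dots> \<le> ennreal (1 - t) * ennreal (b - a) + ennreal t * ennreal (d - c)"
        unfolding x_def y_def P_def Q_def using xin yin
        by (intro add_mono mult_left_mono nn_integral_inverse_density_quantile f g f0 g0 f1 g1 ab)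
           (auto simp: x_def y_def P_def Q_def)
      also have "\<dots> = ennreal ((1 - t) * (b - a) + t * (d - c))"
        using t ab by (simp add: ennreal_mult ennreal_plus)
      also have "\<dots> \<le> ennreal L" using sum by (intro ennreal_leI)
      finally show ?thesis using eL by simp
    next
      case True
      have "z -` C \<inter> space unif01 = {}" using True by (auto simp: J_def space_restrict_space)
      then show ?thesis using C by (simp add: \<rho>_def emeasure_distr)
    qed
  qed simp
  have "(\<integral>\<^sup>+u. h (z u) * ennreal (f (x u) powr (t - 1) * g (y u) powr (- t)) \<partial>unif01)
      \<le> (\<integral>\<^sup>+u. w u * h (z u) \<partial>unif01)"
  proof (rule nn_integral_mono_AE)
    have "AE u in unif01. f (x u) > 0" "AE u in unif01. g (y u) > 0"
      unfolding x_def y_def P_def Q_def by (intro AE_quantile_density_pos f g f1 g1)+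
    then show "AE u in unif01. h (z u) * ennreal (f (x u) powr (t - 1) * g (y u) powr (- t)) \<le> w u * h (z u)"
    proof eventually_elim
      case (elim u)
      have "f (x u) powr (t - 1) * g (y u) powr (- t) = (1 / f (x u)) powr (1 - t) * (1 / g (y u)) powr t"
        using elim powr_minus_divide[of "f (x u)" "1 - t"] powr_minus_divide[of "g (y u)" t]
        by (simp add: powr_divide)
      also have "\<dots> \<le> (1 - t) * (1 / f (x u)) + t * (1 / g (y u))"
        using t elim by (intro Youngs_inequality_0) auto
      finally have "ennreal (f (x u) powr (t - 1) * g (y u) powr (- t)) \<le>
          ennreal ((1 - t) * (1 / f (x u)) + t * (1 / g (y u)))" by (rule ennreal_leI)
      also have "\<dots> = w u"
        using t elim by (simp add: w_def flip: ennreal_plus ennreal_mult)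
      finally show ?case
        by (subst mult.commute) (rule mult_right_mono, simp_all)
    qed
  qed
  also have "\<dots> = (\<integral>\<^sup>+s. h s \<partial>\<rho>)"
    unfolding \<rho>_def by (subst nn_integral_distr) (auto simp: nn_integral_density)
  also have "\<dots> \<le> (\<integral>\<^sup>+s. h s \<partial>lborel)"
    using emeasure_le_lborel_of_intervals[OF sets_\<rho> interval] sets_\<rho>
    by (intro nn_integral_mono_emeasure) (auto cong: measurable_cong_sets)
  finally show ?thesis unfolding z_def x_def y_def .
qed

section \<open>Conditional densities and quantiles of one coordinate\<close>

text \<open>
  The quantile at level \<open>u\<close> is at most \<open>a\<close> exactly if \<open>u\<close> is at most the distribution function at
  \<open>a\<close>, and the latter is an integral over \<open>k\<close>, hence measurable in the parameter.
\<close>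

lemma measurable_quantile_kernel:
  fixes k :: "'a \<Rightarrow> real \<Rightarrow> real"
  assumes k[measurable]: "case_prod k \<in> borel_measurable (N \<Otimes>\<^sub>M lborel)"
    and k1: "\<And>x. x \<in> space N \<Longrightarrow> (\<integral>\<^sup>+s. ennreal (k x s) \<partial>lborel) = 1"
  shows "(\<lambda>(x, u). quantile (density lborel (\<lambda>s. ennreal (k x s))) u) \<in> borel_measurable (N \<Otimes>\<^sub>M unif01)"
proof (rule borel_measurableI_le)
  fix a :: real
  let ?P = "\<lambda>x. density lborel (\<lambda>s. ennreal (k x s))"
  let ?c = "\<lambda>x. enn2real (\<integral>\<^sup>+s. ennreal (k x s) * indicator {..a} s \<partial>lborel)"
  have cdf: "cdf (?P x) a = ?c x" if "x \<in> space N" for x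
    using measurable_compose[OF measurable_Pair1'[OF that] k]
    by (simp add: cdf_def measure_def emeasure_density)
  have "quantile (?P x) u \<le> a \<longleftrightarrow> u \<le> ?c x"
    if "x \<in> space N" "u \<in> {0<..<1}" for x u
  proof -
    have [measurable]: "k x \<in> borel_measurable borel"
      using measurable_compose[OF measurable_Pair1'[OF that(1)] k] by simp
    interpret real_distribution "?P x"
      by (rule real_distribution_density) (use that k1 in auto)
    show ?thesis using quantile_le_iff[of u a] that cdf by auto
  qed
  then have "{w \<in> space (N \<Otimes>\<^sub>M unif01). (\<lambda>(x, u). quantile (?P x) u) w \<le> a}
     = {w \<in> space (N \<Otimes>\<^sub>M unif01). snd w \<le> ?c (fst w)}"
    by (auto simp: space_pair_measure space_restrict_space)
  also have "\<dots> \<in> sets (N \<Otimes>\<^sub>M unif01)"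
  proof -
    have [measurable]: "(\<lambda>w. snd w) \<in> borel_measurable (N \<Otimes>\<^sub>M unif01)"
      by (rule measurable_compose[OF measurable_snd]) (auto intro: measurable_restrict_space1)
    have [measurable]: "?c \<in> borel_measurable N" by measurable
    show ?thesis by measurable
  qed
  finally show "{w \<in> space (N \<Otimes>\<^sub>M unif01). (\<lambda>(x, u). quantile (?P x) u) w \<le> a} \<in> sets (N \<Otimes>\<^sub>M unif01)" .
qed

abbreviation coord_measure :: "'i set \<Rightarrow> ('i \<Rightarrow> real) measure" where
  "coord_measure I \<equiv> PiM I (\<lambda>_. lborel)"

text \<open>
  A section with infinite integral gets marginal density 0; for an integrable \<open>f\<close> such sections
  form a null set.
\<close>

definition marginal_density :: "'i \<Rightarrow> (('i \<Rightarrow> real) \<Rightarrow> real) \<Rightarrow> ('i \<Rightarrow> real) \<Rightarrow> real" where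
  "marginal_density i f x = enn2real (\<integral>\<^sup>+s. ennreal (f (x(i := s))) \<partial>lborel)"

text \<open>
  Where the marginal density vanishes, the uniform density serves as a default value: every
  section is then a probability density, so that the kernel has no exceptional points.
\<close>

definition conditional_density :: "'i \<Rightarrow> (('i \<Rightarrow> real) \<Rightarrow> real) \<Rightarrow> ('i \<Rightarrow> real) \<Rightarrow> real \<Rightarrow> real" where
  "conditional_density i f x s = (if marginal_density i f x = 0 then indicator {0..1} s
     else f (x(i := s)) / marginal_density i f x)"

definition conditional_quantile :: "'i \<Rightarrow> (('i \<Rightarrow> real) \<Rightarrow> real) \<Rightarrow> ('i \<Rightarrow> real) \<Rightarrow> real \<Rightarrow> real" where
  "conditional_quantile i f x = quantile (density lborel (\<lambda>s. ennreal (conditional_density i f x s)))"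

locale coord_density =
  fixes I :: "'i set" and i :: 'i and f :: "('i \<Rightarrow> real) \<Rightarrow> real"
  assumes fin: "finite I" and i: "i \<notin> I"
    and f[measurable]: "f \<in> borel_measurable (coord_measure (insert i I))"
    and f0: "\<And>x. f x \<ge> 0"
    and f1: "(\<integral>\<^sup>+x. ennreal (f x) \<partial>coord_measure (insert i I)) = 1"
begin

sublocale product_sigma_finite "\<lambda>_::'i. lborel :: real measure"
  by standard

lemma upd[measurable]: "(\<lambda>(x, s). x(i := s)) \<in> measurable (coord_measure I \<Otimes>\<^sub>M lborel) (coord_measure (insert i I))"
  by (rule measurable_add_dim)

lemma f_upd[measurable]: "(\<lambda>(x, s). f (x(i := s))) \<in> borel_measurable (coord_measure I \<Otimes>\<^sub>M lborel)"
  using measurable_compose[OF upd f] by (simp add: split_beta')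

lemma marginal_measurable[measurable]: "marginal_density i f \<in> borel_measurable (coord_measure I)"
  unfolding marginal_density_def[abs_def] by measurable

lemma marginal_nonneg: "marginal_density i f x \<ge> 0"
  by (simp add: marginal_density_def)

lemma conditional_measurable[measurable]:
  "case_prod (conditional_density i f) \<in> borel_measurable (coord_measure I \<Otimes>\<^sub>M lborel)"
  unfolding conditional_density_def[abs_def] by measurable

lemma conditional_nonneg: "conditional_density i f x s \<ge> 0"
  using f0 by (auto simp: conditional_density_def marginal_nonneg)

lemma marginal_eq:
  assumes "marginal_density i f x \<noteq> 0"
  shows "ennreal (marginal_density i f x) = (\<integral>\<^sup>+s. ennreal (f (x(i := s))) \<partial>lborel)"
  using assms unfolding marginal_density_def
  by (cases "(\<integral>\<^sup>+s. ennreal (f (x(i := s))) \<partial>lborel)" rule: ennreal_cases) auto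

lemma f_section[measurable]: "x \<in> space (coord_measure I) \<Longrightarrow> (\<lambda>s. f (x(i := s))) \<in> borel_measurable borel"
  using measurable_compose[OF measurable_Pair1' f_upd] by simp

lemma conditional_section[measurable]:
  "x \<in> space (coord_measure I) \<Longrightarrow> conditional_density i f x \<in> borel_measurable borel"
  using measurable_compose[OF measurable_Pair1' conditional_measurable] by simp

lemma conditional_integral:
  assumes x: "x \<in> space (coord_measure I)"
  shows "(\<integral>\<^sup>+s. ennreal (conditional_density i f x s) \<partial>lborel) = 1"
proof (cases "marginal_density i f x = 0")
  case True
  then show ?thesis by (simp add: conditional_density_def ennreal_indicator)
next
  case False
  let ?m = "marginal_density i f x"
  have m: "?m > 0" using False marginal_nonneg[of x] by simp
  have "(\<integral>\<^sup>+s. ennreal (conditional_density i f x s) \<partial>lborel)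
      = (\<integral>\<^sup>+s. ennreal (1 / ?m) * ennreal (f (x(i := s))) \<partial>lborel)"
    using False f0 m by (intro nn_integral_cong) (simp add: conditional_density_def flip: ennreal_mult)
  also have "\<dots> = ennreal (1 / ?m) * ennreal ?m"
    using x marginal_eq[OF False] by (subst nn_integral_cmult) auto
  also have "\<dots> = 1" using m by (simp flip: ennreal_mult)
  finally show ?thesis .
qed

lemma marginal_finite: "AE x in coord_measure I. (\<integral>\<^sup>+s. ennreal (f (x(i := s))) \<partial>lborel) < \<infinity>"
proof -
  have "(\<integral>\<^sup>+x. \<integral>\<^sup>+s. ennreal (f (x(i := s))) \<partial>lborel \<partial>coord_measure I) = 1"
    using f1 by (subst (asm) product_nn_integral_insert[OF fin i]) auto
  then have "AE x in coord_measure I. (\<integral>\<^sup>+s. ennreal (f (x(i := s))) \<partial>lborel) \<noteq> \<infinity>"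
    by (intro nn_integral_PInf_AE) auto
  then show ?thesis by (simp add: less_top)
qed

lemma quantile_measurable[measurable]:
  "(\<lambda>(x, u). conditional_quantile i f x u) \<in> borel_measurable (coord_measure I \<Otimes>\<^sub>M unif01)"
  unfolding conditional_quantile_def
  by (rule measurable_quantile_kernel) (use conditional_integral in auto)

lemma upd_quantile_measurable[measurable]:
  "(\<lambda>(x, u). x(i := conditional_quantile i f x u))
     \<in> measurable (coord_measure I \<Otimes>\<^sub>M unif01) (coord_measure (insert i I))"
proof -
  have "(\<lambda>w. (fst w, conditional_quantile i f (fst w) (snd w)))
      \<in> measurable (coord_measure I \<Otimes>\<^sub>M unif01) (coord_measure I \<Otimes>\<^sub>M lborel)"
    using quantile_measurable by (intro measurable_Pair) (auto simp: split_beta')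
  from measurable_compose[OF this upd] show ?thesis by (simp add: split_beta')
qed

lemma marginal_total: "(\<integral>\<^sup>+x. ennreal (marginal_density i f x) \<partial>coord_measure I) = 1"
proof -
  have "(\<integral>\<^sup>+x. ennreal (marginal_density i f x) \<partial>coord_measure I)
      = (\<integral>\<^sup>+x. \<integral>\<^sup>+s. ennreal (f (x(i := s))) \<partial>lborel \<partial>coord_measure I)"
    by (rule nn_integral_cong_AE, use marginal_finite in eventually_elim)
       (simp add: marginal_density_def less_top[symmetric])
  also have "\<dots> = 1" using f1 by (subst (asm) product_nn_integral_insert[OF fin i]) auto
  finally show ?thesis .
qed

text \<open>
  Disintegration: sampling the other coordinates from the marginal and then coordinate \<open>i\<close> by its
  conditional quantile at a uniform level reproduces the measure with density \<open>f\<close>.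
\<close>

lemma integral_conditional_quantile:
  assumes p[measurable]: "p \<in> borel_measurable (coord_measure (insert i I))"
  shows "(\<integral>\<^sup>+x. \<integral>\<^sup>+u. p (x(i := conditional_quantile i f x u)) \<partial>unif01
            \<partial>density (coord_measure I) (\<lambda>x. ennreal (marginal_density i f x)))
       = (\<integral>\<^sup>+x. p x \<partial>density (coord_measure (insert i I)) (\<lambda>x. ennreal (f x)))"
proof -
  let ?m = "marginal_density i f"
  have p_upd[measurable]: "(\<lambda>(x, s). p (x(i := s))) \<in> borel_measurable (coord_measure I \<Otimes>\<^sub>M lborel)"
    using measurable_compose[OF upd p] by (simp add: split_beta')
  have inner: "(\<integral>\<^sup>+u. p (x(i := conditional_quantile i f x u)) \<partial>unif01)
      = (\<integral>\<^sup>+s. ennreal (conditional_density i f x s) * p (x(i := s)) \<partial>lborel)"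
    if x: "x \<in> space (coord_measure I)" for x
  proof -
    let ?P = "density lborel (\<lambda>s. ennreal (conditional_density i f x s))"
    have [measurable]: "conditional_density i f x \<in> borel_measurable borel" using x by measurable
    have [measurable]: "(\<lambda>s. p (x(i := s))) \<in> borel_measurable borel"
      using measurable_compose[OF measurable_Pair1'[OF x] p_upd] by simp
    interpret real_distribution ?P
      using x by (intro real_distribution_density conditional_integral) auto
    note [measurable] = measurable_quantile
    have "(\<integral>\<^sup>+u. p (x(i := conditional_quantile i f x u)) \<partial>unif01)
        = (\<integral>\<^sup>+s. p (x(i := s)) \<partial>distr unif01 borel (quantile ?P))"
      unfolding conditional_quantile_def by (subst nn_integral_distr) auto
    then show ?thesis unfolding distr_quantile by (simp add: nn_integral_density)
  qed
  have "(\<integral>\<^sup>+x. \<integral>\<^sup>+u. p (x(i := conditional_quantile i f x u)) \<partial>unif01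
            \<partial>density (coord_measure I) (\<lambda>x. ennreal (?m x)))
      = (\<integral>\<^sup>+x. \<integral>\<^sup>+s. ennreal (conditional_density i f x s) * p (x(i := s)) \<partial>lborel
            \<partial>density (coord_measure I) (\<lambda>x. ennreal (?m x)))"
    by (intro nn_integral_cong inner) simp
  also have "\<dots> = (\<integral>\<^sup>+x. ennreal (?m x) * (\<integral>\<^sup>+s. ennreal (conditional_density i f x s) * p (x(i := s)) \<partial>lborel)
            \<partial>coord_measure I)"
    by (subst nn_integral_density) auto
  also have "\<dots> = (\<integral>\<^sup>+x. \<integral>\<^sup>+s. ennreal (f (x(i := s))) * p (x(i := s)) \<partial>lborel \<partial>coord_measure I)"
  proof (rule nn_integral_cong_AE, use marginal_finite AE_space in eventually_elim)
    case (elim x)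
    have [measurable]: "conditional_density i f x \<in> borel_measurable borel"
      "(\<lambda>s. f (x(i := s))) \<in> borel_measurable borel" using elim by measurable
    have [measurable]: "(\<lambda>s. p (x(i := s))) \<in> borel_measurable borel"
      using measurable_compose[OF measurable_Pair1'[OF elim(2)] p_upd] by simp
    have "AE s in lborel. ennreal (?m x) * ennreal (conditional_density i f x s) = ennreal (f (x(i := s)))"
    proof (cases "?m x = 0")
      case True
      with elim have "(\<integral>\<^sup>+s. ennreal (f (x(i := s))) \<partial>lborel) = 0"
        by (auto simp: marginal_density_def enn2real_eq_0_iff)
      then have "AE s in lborel. ennreal (f (x(i := s))) = 0" by (subst (asm) nn_integral_0_iff_AE) auto
      then show ?thesis using True by auto
    next
      case False
      then show ?thesis using f0 marginal_nonneg[of x]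
        by (simp add: conditional_density_def flip: ennreal_mult)
    qed
    then have "(\<integral>\<^sup>+s. ennreal (?m x) * (ennreal (conditional_density i f x s) * p (x(i := s))) \<partial>lborel)
       = (\<integral>\<^sup>+s. ennreal (f (x(i := s))) * p (x(i := s)) \<partial>lborel)"
      by (intro nn_integral_cong_AE) (auto simp: mult.assoc[symmetric])
    then show ?case by (simp add: nn_integral_cmult)
  qed
  also have "\<dots> = (\<integral>\<^sup>+x. ennreal (f x) * p x \<partial>coord_measure (insert i I))"
    by (subst product_nn_integral_insert[OF fin i]) auto
  also have "\<dots> = (\<integral>\<^sup>+x. p x \<partial>density (coord_measure (insert i I)) (\<lambda>x. ennreal (f x)))"
    by (subst nn_integral_density) auto
  finally show ?thesis .
qed

end

section \<open>Triangular couplings in several dimensions\<close>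

text \<open>
  The classical Prekopa-Leindler inequality asserts \<open>\<integral> h \<ge> 1\<close> if \<open>h\<close> at the point \<open>comb t x y\<close>, the
  convex combination with weight \<open>t\<close> at \<open>y\<close>, is at least \<open>f x powr (1 - t) * g y powr t\<close>.  Here
  the ratio of the two sides is averaged over a coupling that depends neither on \<open>t\<close> nor on \<open>h\<close>.
  The convention \<open>0 powr a = 0\<close> affects only a null set of \<open>\<gamma>\<close>.
\<close>

definition prekopa_leindler_coupling ::
    "'a measure \<Rightarrow> (real \<Rightarrow> 'a \<Rightarrow> 'a \<Rightarrow> 'a) \<Rightarrow> ('a \<Rightarrow> real) \<Rightarrow> ('a \<Rightarrow> real) \<Rightarrow> ('a \<times> 'a) measure \<Rightarrow> bool" where
  "prekopa_leindler_coupling M comb f g \<gamma> \<longleftrightarrow>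
     prob_space \<gamma> \<and> sets \<gamma> = sets (M \<Otimes>\<^sub>M M) \<and>
     distr \<gamma> M fst = density M (\<lambda>x. ennreal (f x)) \<and>
     distr \<gamma> M snd = density M (\<lambda>x. ennreal (g x)) \<and>
     (\<forall>t h. 0 < t \<longrightarrow> t < 1 \<longrightarrow> h \<in> borel_measurable M \<longrightarrow>
        (\<integral>\<^sup>+w. h (comb t (fst w) (snd w)) * ennreal (f (fst w) powr (t - 1) * g (snd w) powr (- t)) \<partial>\<gamma>)
          \<le> (\<integral>\<^sup>+x. h x \<partial>M))"

definition coord_comb :: "'i set \<Rightarrow> real \<Rightarrow> ('i \<Rightarrow> real) \<Rightarrow> ('i \<Rightarrow> real) \<Rightarrow> 'i \<Rightarrow> real" where
  "coord_comb I t x y = (\<lambda>i\<in>I. (1 - t) * x i + t * y i)"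

lemma measurable_coord_comb[measurable]:
  "(\<lambda>w. coord_comb I t (fst w) (snd w)) \<in> measurable (coord_measure I \<Otimes>\<^sub>M coord_measure I) (coord_measure I)"
  unfolding coord_comb_def by measurable

lemma coord_comb_upd:
  assumes "i \<notin> I"
  shows "coord_comb (insert i I) t (x(i := a)) (y(i := b)) = (coord_comb I t x y)(i := (1 - t) * a + t * b)"
  using assms by (auto simp: coord_comb_def fun_eq_iff)

lemma prekopa_leindler_coupling_empty:
  fixes f g :: "('i \<Rightarrow> real) \<Rightarrow> real"
  assumes "(\<integral>\<^sup>+x. ennreal (f x) \<partial>coord_measure {}) = 1" "(\<integral>\<^sup>+x. ennreal (g x) \<partial>coord_measure {}) = 1"
  shows "\<exists>\<gamma>. prekopa_leindler_coupling (coord_measure {}) (coord_comb {}) f g \<gamma>"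
proof -
  let ?N = "coord_measure {} :: ('i \<Rightarrow> real) measure"
  let ?\<omega> = "\<lambda>_. undefined :: real"
  have N: "?N = count_space {?\<omega>}" by (rule PiM_empty)
  have "f ?\<omega> = 1" "g ?\<omega> = 1"
    using assms unfolding N by (auto simp: nn_integral_count_space_finite)
  then have dens: "density ?N (\<lambda>x. ennreal (f x)) = ?N" "density ?N (\<lambda>x. ennreal (g x)) = ?N"
    unfolding N by (auto intro!: measure_eqI simp: emeasure_density nn_integral_count_space_finite
        emeasure_count_space_finite subset_singleton_iff)
  have "prob_space ?N" unfolding N by (auto intro!: prob_spaceI)
  then interpret prob_space ?N .
  define \<gamma> where "\<gamma> = distr ?N (?N \<Otimes>\<^sub>M ?N) (\<lambda>x. (x, x))"
  have "prekopa_leindler_coupling ?N (coord_comb {}) f g \<gamma>"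
    unfolding prekopa_leindler_coupling_def
  proof (intro conjI allI impI)
    show "prob_space \<gamma>" unfolding \<gamma>_def by (rule prob_space_distr) auto
    show "sets \<gamma> = sets (?N \<Otimes>\<^sub>M ?N)" by (simp add: \<gamma>_def)
    show "distr \<gamma> ?N fst = density ?N (\<lambda>x. ennreal (f x))"
      unfolding \<gamma>_def dens by (subst distr_distr) (auto simp: comp_def intro: distr_id)
    show "distr \<gamma> ?N snd = density ?N (\<lambda>x. ennreal (g x))"
      unfolding \<gamma>_def dens by (subst distr_distr) (auto simp: comp_def intro: distr_id)
    fix t :: real and h :: "('i \<Rightarrow> real) \<Rightarrow> ennreal"
    have *: "(\<lambda>x. (x, x)) \<in> measurable ?N (?N \<Otimes>\<^sub>M ?N)" by simp
    have m: "(\<lambda>w. F (fst w) (snd w)) \<in> borel_measurable (?N \<Otimes>\<^sub>M ?N)" for F :: "('i \<Rightarrow> real) \<Rightarrow> ('i \<Rightarrow> real) \<Rightarrow> ennreal"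
      unfolding N by (simp add: pair_measure_countable)
    have "(\<integral>\<^sup>+w. h (coord_comb {} t (fst w) (snd w)) * ennreal (f (fst w) powr (t - 1) * g (snd w) powr (- t)) \<partial>\<gamma>)
       = (\<integral>\<^sup>+x. h (coord_comb {} t x x) * ennreal (f x powr (t - 1) * g x powr (- t)) \<partial>?N)"
      unfolding \<gamma>_def using m[of "\<lambda>x y. h (coord_comb {} t x y) * ennreal (f x powr (t - 1) * g y powr (- t))"]
      by (subst nn_integral_distr[OF *]) simp_all
    also have "\<dots> \<le> (\<integral>\<^sup>+x. h x \<partial>?N)"
      unfolding N using \<open>f ?\<omega> = 1\<close> \<open>g ?\<omega> = 1\<close>
      by (simp add: nn_integral_count_space_finite coord_comb_def restrict_def)
    finally show "(\<integral>\<^sup>+w. h (coord_comb {} t (fst w) (snd w)) * ennreal (f (fst w) powr (t - 1) * g (snd w) powr (- t)) \<partial>\<gamma>)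
       \<le> (\<integral>\<^sup>+x. h x \<partial>?N)" .
  qed
  then show ?thesis by blast
qed

text \<open>
  The one-dimensional inequality applied to the conditional densities of coordinate \<open>i\<close>, given that
  the other coordinates are \<open>x\<close> for \<open>f\<close> and \<open>y\<close> for \<open>g\<close>: the marginal densities factor out of the
  powers.
\<close>

lemma conditional_prekopa_leindler:
  fixes f g :: "('i \<Rightarrow> real) \<Rightarrow> real" and h :: "('i \<Rightarrow> real) \<Rightarrow> ennreal"
  assumes "coord_density I i f" "coord_density I i g"
    and x: "x \<in> space (coord_measure I)" "marginal_density i f x > 0"
    and y: "y \<in> space (coord_measure I)" "marginal_density i g y > 0"
    and h: "h \<in> borel_measurable (coord_measure (insert i I))"
    and t: "0 < t" "t < 1"
  defines "a \<equiv> conditional_quantile i f x" and "b \<equiv> conditional_quantile i g y"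
  shows "(\<integral>\<^sup>+u. h (coord_comb (insert i I) t (x(i := a u)) (y(i := b u))) *
            ennreal (f (x(i := a u)) powr (t - 1) * g (y(i := b u)) powr (- t)) \<partial>unif01)
      \<le> (\<integral>\<^sup>+s. h ((coord_comb I t x y)(i := s)) \<partial>lborel) *
          ennreal (marginal_density i f x powr (t - 1) * marginal_density i g y powr (- t))"
proof -
  interpret f: coord_density I i f by fact
  interpret g: coord_density I i g by fact
  let ?F = "marginal_density i f x" and ?G = "marginal_density i g y"
  let ?z = "coord_comb I t x y"
  have z: "?z \<in> space (coord_measure I)" by (simp add: coord_comb_def space_PiM)
  have [measurable]: "(\<lambda>s. h (?z(i := s))) \<in> borel_measurable borel"
    using measurable_compose[OF measurable_Pair1'[OF z] measurable_compose[OF f.upd h]] by simp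
  have fx: "f (x(i := s)) = ?F * conditional_density i f x s" for s
    using x by (simp add: conditional_density_def)
  have gy: "g (y(i := s)) = ?G * conditional_density i g y s" for s
    using y by (simp add: conditional_density_def)
  let ?k = "conditional_density i f x" and ?l = "conditional_density i g y"
  have mk: "a \<in> borel_measurable unif01" "b \<in> borel_measurable unif01"
    unfolding a_def b_def conditional_quantile_def
    by (intro real_distribution.measurable_quantile real_distribution_density
        f.conditional_integral g.conditional_integral f.conditional_section g.conditional_section x y)+
  note [measurable] = mk f.conditional_section[OF x(1)] g.conditional_section[OF y(1)]
  have "(\<integral>\<^sup>+u. h (coord_comb (insert i I) t (x(i := a u)) (y(i := b u))) *
            ennreal (f (x(i := a u)) powr (t - 1) * g (y(i := b u)) powr (- t)) \<partial>unif01)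
     = (\<integral>\<^sup>+u. ennreal (?F powr (t - 1) * ?G powr (- t)) *
         (h (?z(i := (1 - t) * a u + t * b u)) * ennreal (?k (a u) powr (t - 1) * ?l (b u) powr (- t))) \<partial>unif01)"
  proof (rule nn_integral_cong)
    fix u
    have "f (x(i := a u)) powr (t - 1) * g (y(i := b u)) powr (- t) =
      (?F powr (t - 1) * ?G powr (- t)) * (?k (a u) powr (t - 1) * ?l (b u) powr (- t))"
      unfolding fx gy using x y by (simp add: powr_mult f.conditional_nonneg g.conditional_nonneg)
    then show "h (coord_comb (insert i I) t (x(i := a u)) (y(i := b u))) *
            ennreal (f (x(i := a u)) powr (t - 1) * g (y(i := b u)) powr (- t)) =
      ennreal (?F powr (t - 1) * ?G powr (- t)) *
         (h (?z(i := (1 - t) * a u + t * b u)) * ennreal (?k (a u) powr (t - 1) * ?l (b u) powr (- t)))"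
      by (simp only: coord_comb_upd[OF f.i]) (simp add: ennreal_mult mult_ac)
  qed
  also have "\<dots> = ennreal (?F powr (t - 1) * ?G powr (- t)) *
     (\<integral>\<^sup>+u. h (?z(i := (1 - t) * a u + t * b u)) * ennreal (?k (a u) powr (t - 1) * ?l (b u) powr (- t)) \<partial>unif01)"
    by (rule nn_integral_cmult) measurable
  also have "\<dots> \<le> ennreal (?F powr (t - 1) * ?G powr (- t)) * (\<integral>\<^sup>+s. h (?z(i := s)) \<partial>lborel)"
    unfolding a_def b_def conditional_quantile_def
    by (intro mult_left_mono prekopa_leindler_quantile_coupling[of ?k ?l "\<lambda>s. h (?z(i := s))"]
        f.conditional_nonneg g.conditional_nonneg f.conditional_integral g.conditional_integral x y t)
      auto
  finally show ?thesis by (simp add: mult.commute)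
qed

text \<open>
  Given a coupling of the marginals, the new coordinate is added on both sides by conditional
  quantiles at a common uniform level.  The inequality for \<open>h\<close> reduces to the inequality of
  the given coupling for the marginal \<open>\<integral> h (z(i := s)) ds\<close>.
\<close>

lemma prekopa_leindler_coupling_insert:
  fixes f g :: "('i \<Rightarrow> real) \<Rightarrow> real"
  assumes "coord_density I i f" "coord_density I i g"
    and IH: "prekopa_leindler_coupling (coord_measure I) (coord_comb I)
               (marginal_density i f) (marginal_density i g) \<gamma>'"
  shows "\<exists>\<gamma>. prekopa_leindler_coupling (coord_measure (insert i I)) (coord_comb (insert i I)) f g \<gamma>"
proof -
  interpret f: coord_density I i f by fact
  interpret g: coord_density I i g by fact
  interpret U: prob_space unif01 by (rule prob_space_unif01)
  let ?N = "coord_measure I" and ?N' = "coord_measure (insert i I)"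
  let ?F = "marginal_density i f" and ?G = "marginal_density i g"
  from IH have \<gamma>': "prob_space \<gamma>'" and sets[measurable_cong]: "sets \<gamma>' = sets (?N \<Otimes>\<^sub>M ?N)"
    and fst': "distr \<gamma>' ?N fst = density ?N (\<lambda>x. ennreal (?F x))"
    and snd': "distr \<gamma>' ?N snd = density ?N (\<lambda>x. ennreal (?G x))"
    and ineq: "\<And>t h. 0 < t \<Longrightarrow> t < 1 \<Longrightarrow> h \<in> borel_measurable ?N \<Longrightarrow>
        (\<integral>\<^sup>+w. h (coord_comb I t (fst w) (snd w)) * ennreal (?F (fst w) powr (t - 1) * ?G (snd w) powr (- t)) \<partial>\<gamma>')
          \<le> (\<integral>\<^sup>+x. h x \<partial>?N)"
    unfolding prekopa_leindler_coupling_def by blast+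
  interpret \<gamma>': prob_space \<gamma>' by fact
  interpret pair_prob_space \<gamma>' unif01 ..
  let ?qf = "conditional_quantile i f" and ?qg = "conditional_quantile i g"
  define \<Phi> where "\<Phi> = (\<lambda>(w, u). ((fst w)(i := ?qf (fst w) u), (snd w)(i := ?qg (snd w) u)))"
  have upf[measurable]: "(\<lambda>v. (fst (fst v))(i := ?qf (fst (fst v)) (snd v))) \<in> measurable (\<gamma>' \<Otimes>\<^sub>M unif01) ?N'"
    using measurable_compose[of "\<lambda>v. (fst (fst v), snd v)" "\<gamma>' \<Otimes>\<^sub>M unif01" "?N \<Otimes>\<^sub>M unif01",
        OF _ f.upd_quantile_measurable] by simp
  have upg[measurable]: "(\<lambda>v. (snd (fst v))(i := ?qg (snd (fst v)) (snd v))) \<in> measurable (\<gamma>' \<Otimes>\<^sub>M unif01) ?N'"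
    using measurable_compose[of "\<lambda>v. (snd (fst v), snd v)" "\<gamma>' \<Otimes>\<^sub>M unif01" "?N \<Otimes>\<^sub>M unif01",
        OF _ g.upd_quantile_measurable] by simp
  have \<Phi>[measurable]: "\<Phi> \<in> measurable (\<gamma>' \<Otimes>\<^sub>M unif01) (?N' \<Otimes>\<^sub>M ?N')"
    unfolding \<Phi>_def split_beta' by measurable
  define \<gamma> where "\<gamma> = distr (\<gamma>' \<Otimes>\<^sub>M unif01) (?N' \<Otimes>\<^sub>M ?N') \<Phi>"
  have sets_\<gamma>[measurable_cong]: "sets \<gamma> = sets (?N' \<Otimes>\<^sub>M ?N')" by (simp add: \<gamma>_def)
  have int\<gamma>: "(\<integral>\<^sup>+w. H w \<partial>\<gamma>) = (\<integral>\<^sup>+w. \<integral>\<^sup>+u. H ((fst w)(i := ?qf (fst w) u), (snd w)(i := ?qg (snd w) u)) \<partial>unif01 \<partial>\<gamma>')"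
    if [measurable]: "H \<in> borel_measurable (?N' \<Otimes>\<^sub>M ?N')" for H
    unfolding \<gamma>_def by (subst nn_integral_distr) (auto simp: \<Phi>_def split_beta' simp flip: U.nn_integral_fst)
  have [measurable]: "(\<lambda>x. \<integral>\<^sup>+u. p (x(i := ?qf x u)) \<partial>unif01) \<in> borel_measurable ?N"
    "(\<lambda>x. \<integral>\<^sup>+u. p (x(i := ?qg x u)) \<partial>unif01) \<in> borel_measurable ?N"
    if p: "p \<in> borel_measurable ?N'" for p :: "('i \<Rightarrow> real) \<Rightarrow> ennreal"
    using measurable_compose[OF f.upd_quantile_measurable p] measurable_compose[OF g.upd_quantile_measurable p]
    by (auto intro!: U.borel_measurable_nn_integral simp: split_beta')
  have "prekopa_leindler_coupling ?N' (coord_comb (insert i I)) f g \<gamma>"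
    unfolding prekopa_leindler_coupling_def
  proof (intro conjI allI impI)
    show "prob_space \<gamma>" unfolding \<gamma>_def by (rule prob_space_distr) measurable
    show "sets \<gamma> = sets (?N' \<Otimes>\<^sub>M ?N')" by (rule sets_\<gamma>)
    show "distr \<gamma> ?N' fst = density ?N' (\<lambda>x. ennreal (f x))"
    proof (rule measure_eqI)
      fix A assume "A \<in> sets (distr \<gamma> ?N' fst)"
      then have A[measurable]: "A \<in> sets ?N'" by simp
      have "emeasure (distr \<gamma> ?N' fst) A = (\<integral>\<^sup>+x. indicator A x \<partial>distr \<gamma> ?N' fst)" by simp
      also have "\<dots> = (\<integral>\<^sup>+w. indicator A (fst w) \<partial>\<gamma>)" by (subst nn_integral_distr) auto
      also have "\<dots> = (\<integral>\<^sup>+w. \<integral>\<^sup>+u. indicator A ((fst w)(i := ?qf (fst w) u)) \<partial>unif01 \<partial>\<gamma>')"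
        by (subst int\<gamma>) auto
      also have "\<dots> = (\<integral>\<^sup>+x. \<integral>\<^sup>+u. indicator A (x(i := ?qf x u)) \<partial>unif01 \<partial>distr \<gamma>' ?N fst)"
        by (subst nn_integral_distr) auto
      also have "\<dots> = emeasure (density ?N' (\<lambda>x. ennreal (f x))) A"
        unfolding fst' by (subst f.integral_conditional_quantile) auto
      finally show "emeasure (distr \<gamma> ?N' fst) A = emeasure (density ?N' (\<lambda>x. ennreal (f x))) A" .
    qed simp
    show "distr \<gamma> ?N' snd = density ?N' (\<lambda>x. ennreal (g x))"
    proof (rule measure_eqI)
      fix A assume "A \<in> sets (distr \<gamma> ?N' snd)"
      then have A[measurable]: "A \<in> sets ?N'" by simp
      have "emeasure (distr \<gamma> ?N' snd) A = (\<integral>\<^sup>+x. indicator A x \<partial>distr \<gamma> ?N' snd)" by simp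
      also have "\<dots> = (\<integral>\<^sup>+w. indicator A (snd w) \<partial>\<gamma>)" by (subst nn_integral_distr) auto
      also have "\<dots> = (\<integral>\<^sup>+w. \<integral>\<^sup>+u. indicator A ((snd w)(i := ?qg (snd w) u)) \<partial>unif01 \<partial>\<gamma>')"
        by (subst int\<gamma>) auto
      also have "\<dots> = (\<integral>\<^sup>+x. \<integral>\<^sup>+u. indicator A (x(i := ?qg x u)) \<partial>unif01 \<partial>distr \<gamma>' ?N snd)"
        by (subst nn_integral_distr) auto
      also have "\<dots> = emeasure (density ?N' (\<lambda>x. ennreal (g x))) A"
        unfolding snd' by (subst g.integral_conditional_quantile) auto
      finally show "emeasure (distr \<gamma> ?N' snd) A = emeasure (density ?N' (\<lambda>x. ennreal (g x))) A" .
    qed simp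
    fix t :: real and h :: "('i \<Rightarrow> real) \<Rightarrow> ennreal"
    assume t: "0 < t" "t < 1" and h[measurable]: "h \<in> borel_measurable ?N'"
    have hup[measurable]: "(\<lambda>(x, s). h (x(i := s))) \<in> borel_measurable (?N \<Otimes>\<^sub>M lborel)"
      using measurable_compose[OF f.upd h] by (simp add: split_beta')
    have pos: "AE w in \<gamma>'. ?F (fst w) > 0" "AE w in \<gamma>'. ?G (snd w) > 0"
    proof -
      have "AE x in distr \<gamma>' ?N fst. ?F x > 0" "AE x in distr \<gamma>' ?N snd. ?G x > 0"
        unfolding fst' snd' by (subst AE_density; auto simp: ennreal_eq_0_iff)+
      then show "AE w in \<gamma>'. ?F (fst w) > 0" "AE w in \<gamma>'. ?G (snd w) > 0"
        by (auto dest: AE_distrD[rotated])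
    qed
    have "(\<integral>\<^sup>+w. h (coord_comb (insert i I) t (fst w) (snd w)) * ennreal (f (fst w) powr (t - 1) * g (snd w) powr (- t)) \<partial>\<gamma>)
      \<le> (\<integral>\<^sup>+w. (\<integral>\<^sup>+s. h ((coord_comb I t (fst w) (snd w))(i := s)) \<partial>lborel) *
           ennreal (?F (fst w) powr (t - 1) * ?G (snd w) powr (- t)) \<partial>\<gamma>')"
    proof -
      have "(\<lambda>w. h (coord_comb (insert i I) t (fst w) (snd w)) * ennreal (f (fst w) powr (t - 1) * g (snd w) powr (- t)))
        \<in> borel_measurable (?N' \<Otimes>\<^sub>M ?N')" by measurable
      note eq = int\<gamma>[OF this, unfolded fst_conv snd_conv]
      have "space \<gamma>' = space ?N \<times> space ?N"
        using sets_eq_imp_space_eq[OF sets] by (simp only: space_pair_measure)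
      then have sp: "AE w in \<gamma>'. fst w \<in> space ?N \<and> snd w \<in> space ?N"
        by (intro AE_I2) (simp only: mem_Times_iff)
      show ?thesis
        unfolding eq
      proof (rule nn_integral_mono_AE, use pos sp in eventually_elim)
        case (elim w)
        then show ?case
          by (intro conditional_prekopa_leindler assms h t) simp_all
      qed
    qed
    also have "\<dots> \<le> (\<integral>\<^sup>+x. \<integral>\<^sup>+s. h (x(i := s)) \<partial>lborel \<partial>?N)"
      using ineq[OF t, of "\<lambda>x. \<integral>\<^sup>+s. h (x(i := s)) \<partial>lborel"] by simp
    also have "\<dots> = (\<integral>\<^sup>+x. h x \<partial>?N')"
      by (subst f.product_nn_integral_insert[OF f.fin f.i]) auto
    finally show "(\<integral>\<^sup>+w. h (coord_comb (insert i I) t (fst w) (snd w)) * ennreal (f (fst w) powr (t - 1) * g (snd w) powr (- t)) \<partial>\<gamma>)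
      \<le> (\<integral>\<^sup>+x. h x \<partial>?N')" .
  qed
  then show ?thesis by blast
qed

lemma exists_prekopa_leindler_coupling_coord:
  fixes f g :: "('i \<Rightarrow> real) \<Rightarrow> real"
  assumes "finite I"
    and "f \<in> borel_measurable (coord_measure I)" "\<And>x. f x \<ge> 0" "(\<integral>\<^sup>+x. ennreal (f x) \<partial>coord_measure I) = 1"
    and "g \<in> borel_measurable (coord_measure I)" "\<And>x. g x \<ge> 0" "(\<integral>\<^sup>+x. ennreal (g x) \<partial>coord_measure I) = 1"
  shows "\<exists>\<gamma>. prekopa_leindler_coupling (coord_measure I) (coord_comb I) f g \<gamma>"
  using assms
proof (induction I arbitrary: f g rule: finite_induct)
  case empty
  then show ?case by (intro prekopa_leindler_coupling_empty)
next
  case (insert i I)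
  interpret f: coord_density I i f using insert by unfold_locales auto
  interpret g: coord_density I i g using insert by unfold_locales auto
  have "\<exists>\<gamma>'. prekopa_leindler_coupling (coord_measure I) (coord_comb I)
        (marginal_density i f) (marginal_density i g) \<gamma>'"
    by (intro insert.IH f.marginal_measurable g.marginal_measurable f.marginal_nonneg g.marginal_nonneg
        f.marginal_total g.marginal_total)
  then show ?case
    using prekopa_leindler_coupling_insert[OF f.coord_density_axioms g.coord_density_axioms] by blast
qed

text \<open>
  Lebesgue measure is the image of the product measure under the linear map that assembles a
  vector from its coordinates, and a linear map respects convex combinations.
\<close>

theorem exists_prekopa_leindler_coupling:
  fixes f g :: "'a::euclidean_space \<Rightarrow> real"
  assumes f[measurable]: "f \<in> borel_measurable borel" and f0: "\<And>x. f x \<ge> 0"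
    and f1: "(\<integral>\<^sup>+x. ennreal (f x) \<partial>lborel) = 1"
    and g[measurable]: "g \<in> borel_measurable borel" and g0: "\<And>x. g x \<ge> 0"
    and g1: "(\<integral>\<^sup>+x. ennreal (g x) \<partial>lborel) = 1"
  shows "\<exists>\<gamma>. prekopa_leindler_coupling lborel (\<lambda>t x y. (1 - t) *\<^sub>R x + t *\<^sub>R y) f g \<gamma>"
proof -
  let ?N = "coord_measure (Basis :: 'a set)"
  define \<Psi> where "\<Psi> = (\<lambda>x. \<Sum>b\<in>Basis. x b *\<^sub>R b :: 'a)"
  have [measurable]: "\<Psi> \<in> measurable ?N borel" unfolding \<Psi>_def by measurable
  have lb: "lborel = distr ?N borel \<Psi>" unfolding \<Psi>_def by (rule lborel_eq)
  have int: "(\<integral>\<^sup>+x. h x \<partial>lborel) = (\<integral>\<^sup>+x. h (\<Psi> x) \<partial>?N)" if "h \<in> borel_measurable borel" for h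
    using that by (subst lb, subst nn_integral_distr) auto
  have comb: "\<Psi> (coord_comb Basis t x y) = (1 - t) *\<^sub>R \<Psi> x + t *\<^sub>R \<Psi> y" for t x y
    unfolding \<Psi>_def coord_comb_def scaleR_sum_right sum.distrib[symmetric]
    by (intro sum.cong) (auto simp: scaleR_add_left)
  obtain \<gamma>' where "prekopa_leindler_coupling ?N (coord_comb Basis) (f \<circ> \<Psi>) (g \<circ> \<Psi>) \<gamma>'"
    using exists_prekopa_leindler_coupling_coord[of Basis "f \<circ> \<Psi>" "g \<circ> \<Psi>"] f0 g0 f1 g1 int
    by (auto simp: comp_def)
  then have "prob_space \<gamma>'" and sets[measurable_cong]: "sets \<gamma>' = sets (?N \<Otimes>\<^sub>M ?N)"
    and fst': "distr \<gamma>' ?N fst = density ?N (\<lambda>x. ennreal (f (\<Psi> x)))"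
    and snd': "distr \<gamma>' ?N snd = density ?N (\<lambda>x. ennreal (g (\<Psi> x)))"
    and ineq: "\<And>t h. 0 < t \<Longrightarrow> t < 1 \<Longrightarrow> h \<in> borel_measurable ?N \<Longrightarrow>
        (\<integral>\<^sup>+w. h (coord_comb Basis t (fst w) (snd w)) *
           ennreal (f (\<Psi> (fst w)) powr (t - 1) * g (\<Psi> (snd w)) powr (- t)) \<partial>\<gamma>') \<le> (\<integral>\<^sup>+x. h x \<partial>?N)"
    unfolding prekopa_leindler_coupling_def comp_def by blast+
  interpret \<gamma>': prob_space \<gamma>' by fact
  define \<gamma> where "\<gamma> = distr \<gamma>' (borel \<Otimes>\<^sub>M borel) (\<lambda>w. (\<Psi> (fst w), \<Psi> (snd w)))"
  have [measurable_cong]: "sets \<gamma> = sets (borel \<Otimes>\<^sub>M borel)" by (simp add: \<gamma>_def)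
  have dens: "distr (density ?N (\<lambda>x. ennreal (p (\<Psi> x)))) borel \<Psi> = density lborel (\<lambda>x. ennreal (p x))"
    if [measurable]: "p \<in> borel_measurable borel" for p :: "'a \<Rightarrow> real"
    by (subst lb, subst density_distr) auto
  have "prekopa_leindler_coupling lborel (\<lambda>t x y. (1 - t) *\<^sub>R x + t *\<^sub>R y) f g \<gamma>"
    unfolding prekopa_leindler_coupling_def
  proof (intro conjI allI impI)
    show "prob_space \<gamma>" unfolding \<gamma>_def by (rule \<gamma>'.prob_space_distr) measurable
    show "sets \<gamma> = sets (lborel \<Otimes>\<^sub>M lborel)" by (simp add: \<gamma>_def cong: sets_pair_measure_cong)
    have "distr \<gamma> lborel fst = distr \<gamma>' borel (\<lambda>w. \<Psi> (fst w))"
      unfolding \<gamma>_def by (subst distr_distr) (auto simp: comp_def intro!: distr_cong)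
    also have "\<dots> = distr (distr \<gamma>' ?N fst) borel \<Psi>" by (subst distr_distr) (auto simp: comp_def)
    finally show "distr \<gamma> lborel fst = density lborel (\<lambda>x. ennreal (f x))" unfolding fst' dens[OF f] .
    have "distr \<gamma> lborel snd = distr \<gamma>' borel (\<lambda>w. \<Psi> (snd w))"
      unfolding \<gamma>_def by (subst distr_distr) (auto simp: comp_def intro!: distr_cong)
    also have "\<dots> = distr (distr \<gamma>' ?N snd) borel \<Psi>" by (subst distr_distr) (auto simp: comp_def)
    finally show "distr \<gamma> lborel snd = density lborel (\<lambda>x. ennreal (g x))" unfolding snd' dens[OF g] .
    fix t :: real and h :: "'a \<Rightarrow> ennreal"
    assume t: "0 < t" "t < 1" and "h \<in> borel_measurable lborel"
    then have h[measurable]: "h \<in> borel_measurable borel" by simp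
    have "(\<integral>\<^sup>+w. h ((1 - t) *\<^sub>R fst w + t *\<^sub>R snd w) * ennreal (f (fst w) powr (t - 1) * g (snd w) powr (- t)) \<partial>\<gamma>)
      = (\<integral>\<^sup>+w. (h \<circ> \<Psi>) (coord_comb Basis t (fst w) (snd w)) *
           ennreal (f (\<Psi> (fst w)) powr (t - 1) * g (\<Psi> (snd w)) powr (- t)) \<partial>\<gamma>')"
      unfolding \<gamma>_def by (subst nn_integral_distr) (auto simp: comb)
    also have "\<dots> \<le> (\<integral>\<^sup>+x. (h \<circ> \<Psi>) x \<partial>?N)"
      by (intro ineq t) (auto simp: comp_def)
    also have "\<dots> = (\<integral>\<^sup>+x. h x \<partial>lborel)" by (simp add: int)
    finally show "(\<integral>\<^sup>+w. h ((1 - t) *\<^sub>R fst w + t *\<^sub>R snd w) *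
        ennreal (f (fst w) powr (t - 1) * g (snd w) powr (- t)) \<partial>\<gamma>) \<le> (\<integral>\<^sup>+x. h x \<partial>lborel)" .
  qed
  then show ?thesis by blast
qed

section \<open>Transport between a strongly log-concave measure and its linear tilts\<close>

text \<open>
  Both sides of the hypothesis are 1 at \<open>t = 0\<close>, and the claim compares their slopes at this
  point.  The difference quotients of \<open>exp (t * Y)\<close> lie between \<open>Y\<close> and \<open>exp Y - 1\<close> by convexity,
  so that dominated convergence applies although only a one-sided derivative exists.
\<close>

lemma (in prob_space) exponential_tilt_derivative_bound:
  fixes Y :: "'a \<Rightarrow> real"
  assumes Y: "integrable M Y" and eY: "integrable M (\<lambda>w. exp (Y w))"
    and le: "\<And>t. 0 < t \<Longrightarrow> t < 1 \<Longrightarrow> exp (t * \<kappa>) * (1 + t * (1 - t) * c) \<le> expectation (\<lambda>w. exp (t * Y w))"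
  shows "\<kappa> + c \<le> expectation Y"
proof -
  have [measurable]: "Y \<in> borel_measurable M" using Y by simp
  define \<tau> where "\<tau> = (\<lambda>n::nat. 1 / (real n + 2))"
  have \<tau>: "0 < \<tau> n" "\<tau> n < 1" for n by (auto simp: \<tau>_def field_simps)
  define s where "s = (\<lambda>n w. (exp (\<tau> n * Y w) - 1) / \<tau> n)"
  have upper: "exp (\<tau> n * y) \<le> (1 - \<tau> n) + \<tau> n * exp y" for n y
  proof -
    have "exp ((1 - \<tau> n) *\<^sub>R 0 + \<tau> n *\<^sub>R y) \<le> (1 - \<tau> n) * exp 0 + \<tau> n * exp y"
      using \<tau>[of n] by (intro convex_onD[OF exp_convex]) auto
    then show ?thesis by simp
  qed
  have s_upper: "s n w \<le> exp (Y w) - 1" and s_lower: "Y w \<le> s n w" for n w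
  proof -
    have "exp (\<tau> n * Y w) - 1 \<le> \<tau> n * (exp (Y w) - 1)"
      using upper[of n "Y w"] by (simp add: algebra_simps)
    then show "s n w \<le> exp (Y w) - 1" using \<tau>[of n] by (simp add: s_def field_simps)
    have "1 + \<tau> n * Y w \<le> exp (\<tau> n * Y w)" by (rule exp_ge_add_one_self)
    then show "Y w \<le> s n w" using \<tau>[of n] by (simp add: s_def field_simps)
  qed
  have lim: "(\<lambda>n. expectation (s n)) \<longlonglongrightarrow> expectation Y"
  proof (rule integral_dominated_convergence[where w="\<lambda>w. \<bar>Y w\<bar> + exp (Y w) + 1"])
    show "AE w in M. (\<lambda>n. s n w) \<longlonglongrightarrow> Y w"
    proof (rule AE_I2)
      fix w
      show "(\<lambda>n. s n w) \<longlonglongrightarrow> Y w" unfolding s_def \<tau>_def by real_asymp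
    qed
    show "AE w in M. norm (s n w) \<le> \<bar>Y w\<bar> + exp (Y w) + 1" for n
    proof (rule AE_I2)
      fix w
      show "norm (s n w) \<le> \<bar>Y w\<bar> + exp (Y w) + 1"
        using s_upper[of n w] s_lower[of w n] exp_ge_zero[of "Y w"] unfolding real_norm_def by linarith
    qed
    show "s n \<in> borel_measurable M" for n unfolding s_def by measurable
  qed (use Y eY in auto)
  have int: "integrable M (\<lambda>w. exp (\<tau> n * Y w))" for n
  proof (rule Bochner_Integration.integrable_bound)
    show "integrable M (\<lambda>w. 1 + exp (Y w))" using eY by simp
    show "AE w in M. norm (exp (\<tau> n * Y w)) \<le> norm (1 + exp (Y w))"
    proof (rule AE_I2)
      fix w
      have "exp (\<tau> n * Y w) \<le> (1 - \<tau> n) + \<tau> n * exp (Y w)" by (rule upper)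
      also have "\<dots> \<le> 1 + 1 * exp (Y w)"
        using \<tau>[of n] by (intro add_mono mult_right_mono) auto
      finally show "norm (exp (\<tau> n * Y w)) \<le> norm (1 + exp (Y w))" by simp
    qed
  qed simp
  have "(exp (\<tau> n * \<kappa>) * (1 + \<tau> n * (1 - \<tau> n) * c) - 1) / \<tau> n \<le> expectation (s n)" for n
  proof -
    have "expectation (s n) = (expectation (\<lambda>w. exp (\<tau> n * Y w)) - 1) / \<tau> n"
      unfolding s_def using int[of n] by (simp add: prob_space)
    then show ?thesis using le[OF \<tau>[of n]] \<tau>[of n] by (simp add: divide_right_mono)
  qed
  moreover have "(\<lambda>n. (exp (\<tau> n * \<kappa>) * (1 + \<tau> n * (1 - \<tau> n) * c) - 1) / \<tau> n) \<longlonglongrightarrow> \<kappa> + c"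
    unfolding \<tau>_def by real_asymp
  ultimately show ?thesis using lim by (intro LIMSEQ_le) auto
qed

lemma exponential_tilt:
  fixes f0 q :: "'a::euclidean_space \<Rightarrow> real"
  assumes f0: "integrable lborel f0" "\<And>x. f0 x \<ge> 0" and q[measurable]: "q \<in> borel_measurable borel"
    and fq: "integrable lborel (\<lambda>x. f0 x * exp (q x))"
    and Z: "Z = (\<integral>x. f0 x \<partial>lborel)" "Z > 0"
  defines "\<mu> \<equiv> density lborel (\<lambda>x. ennreal (f0 x / Z))"
  shows "(\<integral>\<^sup>+x. ennreal (f0 x / Z) \<partial>lborel) = 1" and "prob_space \<mu>"
    and "integrable \<mu> (\<lambda>x. exp (q x))"
    and "\<And>t. 0 < t \<Longrightarrow> t < 1 \<Longrightarrow>
      (\<integral>\<^sup>+x. ennreal (f0 x * exp (t * q x)) \<partial>lborel) = ennreal (Z * (\<integral>x. exp (t * q x) \<partial>\<mu>))"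
proof -
  have [measurable]: "f0 \<in> borel_measurable borel" using f0 by (auto dest: borel_measurable_integrable)
  have f0i: "integrable lborel (\<lambda>x. f0 x / Z)" using f0 by simp
  have "(\<integral>\<^sup>+x. ennreal (f0 x / Z) \<partial>lborel) = ennreal (\<integral>x. f0 x / Z \<partial>lborel)"
    using f0 Z f0i by (intro nn_integral_eq_integral) auto
  also have "\<dots> = 1" using Z by simp
  finally show one: "(\<integral>\<^sup>+x. ennreal (f0 x / Z) \<partial>lborel) = 1" .
  then show "prob_space \<mu>" unfolding \<mu>_def
    by (intro prob_spaceI) (simp add: emeasure_density)
  show "integrable \<mu> (\<lambda>x. exp (q x))"
    unfolding \<mu>_def using fq f0 Z by (subst integrable_density) auto
  fix t :: real assume t: "0 < t" "t < 1"
  have int: "integrable lborel (\<lambda>x. f0 x * exp (t * q x))"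
  proof (rule Bochner_Integration.integrable_bound)
    show "integrable lborel (\<lambda>x. f0 x + f0 x * exp (q x))" using fq f0 by simp
    show "AE x in lborel. norm (f0 x * exp (t * q x)) \<le> norm (f0 x + f0 x * exp (q x))"
    proof (rule AE_I2)
      fix x
      have "exp ((1 - t) *\<^sub>R 0 + t *\<^sub>R q x) \<le> (1 - t) * exp 0 + t * exp (q x)"
        using t by (intro convex_onD[OF exp_convex]) auto
      also have "\<dots> \<le> 1 + 1 * exp (q x)"
        using t by (intro add_mono mult_right_mono) auto
      finally have "f0 x * exp (t * q x) \<le> f0 x * (1 + exp (q x))"
        using f0 by (intro mult_left_mono) auto
      then show "norm (f0 x * exp (t * q x)) \<le> norm (f0 x + f0 x * exp (q x))"
        using f0(2)[of x] by (simp add: algebra_simps)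
    qed
  qed simp
  have "(\<integral>x. exp (t * q x) \<partial>\<mu>) = (\<integral>x. (f0 x / Z) * exp (t * q x) \<partial>lborel)"
    unfolding \<mu>_def using f0 Z by (subst integral_density) auto
  also have "\<dots> = (\<integral>x. f0 x * exp (t * q x) \<partial>lborel) / Z" by simp
  finally have "Z * (\<integral>x. exp (t * q x) \<partial>\<mu>) = (\<integral>x. f0 x * exp (t * q x) \<partial>lborel)"
    using Z(2) by simp
  then show "(\<integral>\<^sup>+x. ennreal (f0 x * exp (t * q x)) \<partial>lborel) = ennreal (Z * (\<integral>x. exp (t * q x) \<partial>\<mu>))"
    using f0 int by (simp add: nn_integral_eq_integral)
qed

lemma integral_le_of_nn_integral_le:
  fixes W :: "'a \<Rightarrow> real"
  assumes "integrable M W" "(\<integral>\<^sup>+x. ennreal (W x) \<partial>M) \<le> ennreal c" "c \<ge> 0"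
  shows "(\<integral>x. W x \<partial>M) \<le> c"
proof -
  have "(\<integral>x. W x \<partial>M) \<le> enn2real (\<integral>\<^sup>+x. ennreal (W x) \<partial>M)"
    using assms(1) by (simp add: real_lebesgue_integral_def)
  also have "\<dots> \<le> enn2real (ennreal c)" using assms(2) by (intro enn2real_mono) auto
  finally show ?thesis using assms(3) by simp
qed

lemma ennreal_sqrt_le:
  assumes "c \<le> ennreal (r\<^sup>2)" "r \<ge> 0"
  shows "ennreal_sqrt c \<le> ennreal r"
proof -
  obtain x where x: "c = ennreal x" "x \<ge> 0"
    using assms(1) by (cases c rule: ennreal_cases) (auto simp: top_unique)
  then have "x \<le> r\<^sup>2" using assms by simp
  then have "sqrt x \<le> r" using assms(2) by (simp add: real_le_lsqrt)
  then show ?thesis using x by (simp add: ennreal_sqrt_def ennreal_leI)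
qed

text \<open>
  With \<open>D = E|x - y|^2\<close> under the coupling, \<open>m0\<close> and \<open>m1\<close> the means of \<open>p \<bullet> x\<close> under the two
  measures and \<open>\<kappa> = ln (Z1 / Z0)\<close>, the slopes at \<open>t = 0\<close> and \<open>t = 1\<close> give
  \<open>\<kappa> + \<alpha>/2 D - (m1 - m0) \<le> m0\<close> and \<open>- \<kappa> + \<alpha>/2 D - (m1 - m0) \<le> - m1\<close>.  Their sum is
  \<open>\<alpha> D \<le> m1 - m0\<close>.
\<close>

theorem wasserstein2_linear_tilt_le:
  fixes V :: "'a::euclidean_space \<Rightarrow> real" and \<Theta> :: "'a set" and p :: 'a
  defines "f0 \<equiv> (\<lambda>x. indicator \<Theta> x * exp (- V x))"
    and "g0 \<equiv> (\<lambda>x. indicator \<Theta> x * exp (- V x + p \<bullet> x))"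
  defines "Z0 \<equiv> \<integral>x. f0 x \<partial>lborel" and "Z1 \<equiv> \<integral>x. g0 x \<partial>lborel"
  assumes \<alpha>: "\<alpha> > 0" and \<Theta>: "convex \<Theta>"
    and strong: "\<And>x y t. x \<in> \<Theta> \<Longrightarrow> y \<in> \<Theta> \<Longrightarrow> 0 < t \<Longrightarrow> t < 1 \<Longrightarrow>
      V ((1 - t) *\<^sub>R x + t *\<^sub>R y) \<le> (1 - t) * V x + t * V y - \<alpha> / 2 * t * (1 - t) * (norm (x - y))\<^sup>2"
    and f0: "integrable lborel f0" "integrable lborel (\<lambda>x. (norm x)\<^sup>2 * f0 x)" "Z0 > 0"
    and g0: "integrable lborel g0" "integrable lborel (\<lambda>x. (norm x)\<^sup>2 * g0 x)" "Z1 > 0"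
  shows "wasserstein2 (density lborel (\<lambda>x. ennreal (f0 x / Z0))) (density lborel (\<lambda>x. ennreal (g0 x / Z1)))
     \<le> ennreal (norm p / \<alpha>)"
proof -
  let ?f = "\<lambda>x. f0 x / Z0" and ?g = "\<lambda>x. g0 x / Z1"
  let ?\<mu> = "density lborel (\<lambda>x. ennreal (?f x))" and ?\<nu> = "density lborel (\<lambda>x. ennreal (?g x))"
  have f0_nn: "f0 x \<ge> 0" and g0_nn: "g0 x \<ge> 0" for x by (auto simp: f0_def g0_def)
  have g0_eq: "g0 x = f0 x * exp (p \<bullet> x)" and f0_eq: "f0 x = g0 x * exp (- (p \<bullet> x))" for x
    by (auto simp: f0_def g0_def exp_add[symmetric] mult.assoc)
  have [measurable]: "f0 \<in> borel_measurable borel" "g0 \<in> borel_measurable borel"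
    using f0 g0 by (auto dest: borel_measurable_integrable)
  have Z0: "Z0 = (\<integral>x. f0 x \<partial>lborel)" and Z1: "Z1 = (\<integral>x. g0 x \<partial>lborel)"
    by (simp_all add: Z0_def Z1_def)
  have pm: "(\<lambda>x. p \<bullet> x) \<in> borel_measurable borel" "(\<lambda>x. - (p \<bullet> x)) \<in> borel_measurable borel"
    by measurable
  have "integrable lborel (\<lambda>x. f0 x * exp (p \<bullet> x))" using g0(1) unfolding g0_eq .
  note F = exponential_tilt[OF f0(1) f0_nn pm(1) this Z0 f0(3)]
  have "integrable lborel (\<lambda>x. g0 x * exp (- (p \<bullet> x)))" using f0(1) unfolding f0_eq .
  note G = exponential_tilt[OF g0(1) g0_nn pm(2) this Z1 g0(3)]
  interpret \<mu>: prob_space ?\<mu> using F(2) .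
  interpret \<nu>: prob_space ?\<nu> using G(2) .
  obtain \<gamma> where "prekopa_leindler_coupling lborel (\<lambda>t x y. (1 - t) *\<^sub>R x + t *\<^sub>R y) ?f ?g \<gamma>"
    using exists_prekopa_leindler_coupling[of ?f ?g] F(1) G(1) f0_nn g0_nn f0(3) g0(3) by auto
  then have "prob_space \<gamma>" and "sets \<gamma> = sets (lborel \<Otimes>\<^sub>M lborel)"
    and fst0: "distr \<gamma> lborel fst = ?\<mu>" and snd0: "distr \<gamma> lborel snd = ?\<nu>"
    and ineq: "\<And>t h. 0 < t \<Longrightarrow> t < 1 \<Longrightarrow> h \<in> borel_measurable borel \<Longrightarrow>
        (\<integral>\<^sup>+w. h ((1 - t) *\<^sub>R fst w + t *\<^sub>R snd w) *
           ennreal (?f (fst w) powr (t - 1) * ?g (snd w) powr (- t)) \<partial>\<gamma>) \<le> (\<integral>\<^sup>+x. h x \<partial>lborel)"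
    unfolding prekopa_leindler_coupling_def by auto
  have sets[measurable_cong]: "sets \<gamma> = sets (borel \<Otimes>\<^sub>M borel)"
    using \<open>sets \<gamma> = _\<close> by (simp cong: sets_pair_measure_cong)
  interpret \<gamma>: prob_space \<gamma> by fact
  have fst: "distr \<gamma> borel fst = ?\<mu>" and snd: "distr \<gamma> borel snd = ?\<nu>"
    unfolding fst0[symmetric] snd0[symmetric] by (auto intro!: distr_cong)
  have \<mu>2: "integrable ?\<mu> (\<lambda>x. (norm x)\<^sup>2)" and \<nu>2: "integrable ?\<nu> (\<lambda>x. (norm x)\<^sup>2)"
    using f0 g0 f0_nn g0_nn by (subst integrable_density; simp add: mult.commute)+
  have inner_int: "integrable M (\<lambda>x. p \<bullet> x)"
    if "prob_space M" "integrable M (\<lambda>x. (norm x)\<^sup>2)" "sets M = sets borel" for M :: "'a measure"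
  proof (rule Bochner_Integration.integrable_bound)
    interpret prob_space M by fact
    show "integrable M (\<lambda>x. norm p * (1 + (norm x)\<^sup>2))" using that by simp
    show "AE x in M. norm (p \<bullet> x) \<le> norm (norm p * (1 + (norm x)\<^sup>2))"
    proof (rule AE_I2)
      fix x :: 'a
      have "norm x \<le> 1 + (norm x)\<^sup>2"
        using sum_power2_ge_zero[of "norm x - 1" "norm x"] by (simp add: power2_eq_square algebra_simps)
      have "\<bar>p \<bullet> x\<bar> \<le> norm p * norm x" by (rule Cauchy_Schwarz_ineq2)
      also have "\<dots> \<le> norm p * (1 + (norm x)\<^sup>2)"
        using \<open>norm x \<le> _\<close> by (intro mult_left_mono) auto
      finally show "norm (p \<bullet> x) \<le> norm (norm p * (1 + (norm x)\<^sup>2))" by simp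
    qed
  qed (use that(3) in \<open>simp cong: measurable_cong_sets\<close>)
  have \<mu>p: "integrable ?\<mu> (\<lambda>x. p \<bullet> x)" using inner_int[OF F(2) \<mu>2] by simp
  have \<nu>p: "integrable ?\<nu> (\<lambda>x. p \<bullet> x)" using inner_int[OF G(2) \<nu>2] by simp
  have \<gamma>fst: "integrable \<gamma> (\<lambda>w. F (fst w)) \<longleftrightarrow> integrable ?\<mu> F"
       "integral\<^sup>L \<gamma> (\<lambda>w. F (fst w)) = integral\<^sup>L ?\<mu> F"
    if [measurable]: "F \<in> borel_measurable borel" for F :: "'a \<Rightarrow> real"
    unfolding fst[symmetric] by (simp_all add: integrable_distr_eq integral_distr)
  have \<gamma>snd: "integrable \<gamma> (\<lambda>w. F (snd w)) \<longleftrightarrow> integrable ?\<nu> F"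
       "integral\<^sup>L \<gamma> (\<lambda>w. F (snd w)) = integral\<^sup>L ?\<nu> F"
    if [measurable]: "F \<in> borel_measurable borel" for F :: "'a \<Rightarrow> real"
    unfolding snd[symmetric] by (simp_all add: integrable_distr_eq integral_distr)
  have \<gamma>2: "integrable \<gamma> (\<lambda>w. (norm (fst w))\<^sup>2)" "integrable \<gamma> (\<lambda>w. (norm (snd w))\<^sup>2)"
    using \<gamma>fst(1)[of "\<lambda>x. (norm x)\<^sup>2"] \<gamma>snd(1)[of "\<lambda>x. (norm x)\<^sup>2"] \<mu>2 \<nu>2 by auto
  have \<gamma>p: "integrable \<gamma> (\<lambda>w. p \<bullet> fst w)" "integrable \<gamma> (\<lambda>w. p \<bullet> snd w)"
    using \<gamma>fst(1)[of "\<lambda>x. p \<bullet> x"] \<gamma>snd(1)[of "\<lambda>x. p \<bullet> x"] \<mu>p \<nu>p by auto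
  define m0 m1 where "m0 = (\<integral>x. p \<bullet> x \<partial>?\<mu>)" and "m1 = (\<integral>x. p \<bullet> x \<partial>?\<nu>)"
  have m: "m0 = (\<integral>w. p \<bullet> fst w \<partial>\<gamma>)" "m1 = (\<integral>w. p \<bullet> snd w \<partial>\<gamma>)"
    unfolding m0_def m1_def by (rule \<gamma>fst(2)[symmetric] \<gamma>snd(2)[symmetric]; measurable)+
  have dist_int: "integrable \<gamma> (\<lambda>w. (norm (fst w - snd w))\<^sup>2)"
  proof (rule Bochner_Integration.integrable_bound)
    show "integrable \<gamma> (\<lambda>w. 2 * (norm (fst w))\<^sup>2 + 2 * (norm (snd w))\<^sup>2)" using \<gamma>2 by simp
    show "AE w in \<gamma>. norm ((norm (fst w - snd w))\<^sup>2) \<le> norm (2 * (norm (fst w))\<^sup>2 + 2 * (norm (snd w))\<^sup>2)"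
    proof (rule AE_I2)
      fix w :: "'a \<times> 'a"
      have "(norm (fst w - snd w))\<^sup>2 \<le> (norm (fst w) + norm (snd w))\<^sup>2"
        by (intro power_mono norm_triangle_ineq4) auto
      also have "\<dots> \<le> 2 * (norm (fst w))\<^sup>2 + 2 * (norm (snd w))\<^sup>2"
        using sum_squares_ge_zero[of "norm (fst w) - norm (snd w)" 0]
        by (simp add: power2_eq_square algebra_simps)
      finally show "norm ((norm (fst w - snd w))\<^sup>2) \<le> norm (2 * (norm (fst w))\<^sup>2 + 2 * (norm (snd w))\<^sup>2)"
        by simp
    qed
  qed measurable
  define D where "D = (\<integral>w. (norm (fst w - snd w))\<^sup>2 \<partial>\<gamma>)"
  define Y where "Y = (\<lambda>w. \<alpha> / 2 * (norm (fst w - snd w))\<^sup>2 - (p \<bullet> snd w - p \<bullet> fst w))"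
  have Y_int: "integrable \<gamma> Y" unfolding Y_def using dist_int \<gamma>p by simp
  have EY: "(\<integral>w. Y w \<partial>\<gamma>) = \<alpha> / 2 * D - (m1 - m0)"
    unfolding Y_def D_def m using dist_int \<gamma>p by simp
  have AE\<Theta>: "AE w in \<gamma>. fst w \<in> \<Theta>" "AE w in \<gamma>. snd w \<in> \<Theta>"
  proof -
    have pos: "x \<in> \<Theta>" if "0 < f0 x \<or> 0 < g0 x" for x
      using that by (cases "x \<in> \<Theta>") (auto simp: f0_def g0_def)
    have "AE x in ?\<mu>. x \<in> \<Theta>"
      using f0(3) by (subst AE_density) (auto intro!: AE_I2 pos simp: zero_less_divide_iff)
    moreover have "AE x in ?\<nu>. x \<in> \<Theta>"
      using g0(3) by (subst AE_density) (auto intro!: AE_I2 pos simp: zero_less_divide_iff)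
    ultimately have "AE x in distr \<gamma> borel fst. x \<in> \<Theta>" "AE x in distr \<gamma> borel snd. x \<in> \<Theta>"
      unfolding fst snd .
    then show "AE w in \<gamma>. fst w \<in> \<Theta>" "AE w in \<gamma>. snd w \<in> \<Theta>"
      by (auto dest: AE_distrD[rotated])
  qed
  define \<kappa> where "\<kappa> = ln Z1 - ln Z0"
  \<comment> \<open>The coupling inequality for \<open>h = f0 * exp (t * (p \<bullet> x))\<close>, whose integral is \<open>c\<close>, after \<open>exp u \<ge> 1 + u\<close>.\<close>
  have key: "exp ((1 - t) * ln Z0 + t * ln Z1) * (1 + t * (1 - t) * (\<alpha> / 2 * D - (m1 - m0))) \<le> c"
    if t: "0 < t" "t < 1"
      and c: "(\<integral>\<^sup>+x. ennreal (f0 x * exp (t * (p \<bullet> x))) \<partial>lborel) = ennreal c" "c \<ge> 0" for t c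
  proof -
    let ?C = "exp ((1 - t) * ln Z0 + t * ln Z1)"
    let ?W = "\<lambda>w. ?C * (1 + t * (1 - t) * Y w)"
    let ?h = "\<lambda>x. ennreal (f0 x * exp (t * (p \<bullet> x)))"
    have pw: "AE w in \<gamma>. ennreal (?W w) \<le> ?h ((1 - t) *\<^sub>R fst w + t *\<^sub>R snd w) *
           ennreal (?f (fst w) powr (t - 1) * ?g (snd w) powr (- t))"
      using AE\<Theta>
    proof eventually_elim
      case (elim w)
      obtain x y where w: "w = (x, y)" by (cases w)
      have xy: "x \<in> \<Theta>" "y \<in> \<Theta>" using elim w by auto
      let ?z = "(1 - t) *\<^sub>R x + t *\<^sub>R y"
      have z: "?z \<in> \<Theta>" using convexD[OF \<Theta> xy, of "1 - t" t] t by auto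
      have fx: "?f x powr (t - 1) = exp ((1 - t) * (V x + ln Z0))"
        using xy f0(3) by (simp add: f0_def powr_def ln_div algebra_simps)
      have gy: "?g y powr (- t) = exp (t * (V y - p \<bullet> y + ln Z1))"
        using xy g0(3) by (simp add: g0_def powr_def ln_div algebra_simps)
      let ?e = "- V ?z + t * (p \<bullet> ?z) + (1 - t) * (V x + ln Z0) + t * (V y - p \<bullet> y + ln Z1)"
      have "V ?z \<le> (1 - t) * V x + t * V y - \<alpha> / 2 * t * (1 - t) * (norm (x - y))\<^sup>2"
        using strong xy t by blast
      moreover have "t * (p \<bullet> ?z) - t * (p \<bullet> y) = - (t * (1 - t) * (p \<bullet> y - p \<bullet> x))"
        by (simp add: inner_add_right algebra_simps)
      ultimately have "(1 - t) * ln Z0 + t * ln Z1 + t * (1 - t) * Y w \<le> ?e"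
        unfolding w Y_def by (simp add: algebra_simps)
      then have "?C * exp (t * (1 - t) * Y w) \<le> exp ?e"
        unfolding exp_add[symmetric] by simp
      moreover have "?W w \<le> ?C * exp (t * (1 - t) * Y w)"
        by (intro mult_left_mono exp_ge_add_one_self) auto
      ultimately have "?W w \<le> exp ?e" by (rule order_trans[rotated])
      also have "exp ?e = (f0 ?z * exp (t * (p \<bullet> ?z))) * (?f x powr (t - 1) * ?g y powr (- t))"
        unfolding fx gy using z by (simp add: f0_def exp_add[symmetric] algebra_simps)
      finally have "ennreal (?W w) \<le> ennreal ((f0 ?z * exp (t * (p \<bullet> ?z))) * (?f x powr (t - 1) * ?g y powr (- t)))"
        by (rule ennreal_leI)
      also have "\<dots> = ?h ?z * ennreal (?f x powr (t - 1) * ?g y powr (- t))"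
        using f0_nn by (intro ennreal_mult) auto
      finally show ?case unfolding w by simp
    qed
    have "(\<integral>\<^sup>+w. ennreal (?W w) \<partial>\<gamma>) \<le> (\<integral>\<^sup>+w. ?h ((1 - t) *\<^sub>R fst w + t *\<^sub>R snd w) *
           ennreal (?f (fst w) powr (t - 1) * ?g (snd w) powr (- t)) \<partial>\<gamma>)"
      by (rule nn_integral_mono_AE[OF pw])
    also have "\<dots> \<le> (\<integral>\<^sup>+x. ?h x \<partial>lborel)" by (intro ineq t) measurable
    also have "\<dots> = ennreal c" by (rule c)
    finally have "(\<integral>w. ?W w \<partial>\<gamma>) \<le> c"
      using Y_int c(2) by (intro integral_le_of_nn_integral_le) auto
    also have "(\<integral>w. ?W w \<partial>\<gamma>) = ?C * (1 + t * (1 - t) * (\<integral>w. Y w \<partial>\<gamma>))"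
      using Y_int by (simp add: \<gamma>.prob_space)
    finally show ?thesis unfolding EY .
  qed
  \<comment> \<open>Slope at \<open>t = 0\<close>: the integral of \<open>h\<close> is \<open>Z0\<close> times an exponential moment of the first measure.\<close>
  have 1: "\<kappa> + (\<alpha> / 2 * D - (m1 - m0)) \<le> m0"
  proof -
    have "exp (t * \<kappa>) * (1 + t * (1 - t) * (\<alpha> / 2 * D - (m1 - m0))) \<le> (\<integral>x. exp (t * (p \<bullet> x)) \<partial>?\<mu>)"
      if t: "0 < t" "t < 1" for t
    proof -
      have "exp ((1 - t) * ln Z0 + t * ln Z1) = Z0 * exp (t * \<kappa>)"
      proof -
        have "(1 - t) * ln Z0 + t * ln Z1 = ln Z0 + t * \<kappa>" by (simp add: \<kappa>_def algebra_simps)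
        then show ?thesis using f0(3) by (simp only: exp_add exp_ln)
      qed
      then have "Z0 * (exp (t * \<kappa>) * (1 + t * (1 - t) * (\<alpha> / 2 * D - (m1 - m0)))) \<le> Z0 * (\<integral>x. exp (t * (p \<bullet> x)) \<partial>?\<mu>)"
        using key[OF t F(4)[OF t]] f0(3) by (simp add: mult.assoc)
      then show ?thesis using f0(3) by simp
    qed
    then show "\<kappa> + (\<alpha> / 2 * D - (m1 - m0)) \<le> m0"
      unfolding m0_def by (intro \<mu>.exponential_tilt_derivative_bound \<mu>p F(3)) auto
  qed
  \<comment> \<open>Slope at \<open>t = 1\<close>: seen from the second measure, \<open>h\<close> is the tilt by \<open>- p\<close> with parameter \<open>s = 1 - t\<close>.\<close>
  have 2: "- \<kappa> + (\<alpha> / 2 * D - (m1 - m0)) \<le> - m1"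
  proof -
    have "exp (s * (- \<kappa>)) * (1 + s * (1 - s) * (\<alpha> / 2 * D - (m1 - m0))) \<le> (\<integral>x. exp (s * (- (p \<bullet> x))) \<partial>?\<nu>)"
      if s: "0 < s" "s < 1" for s
    proof -
      define t where "t = 1 - s"
      have t: "0 < t" "t < 1" "s = 1 - t" using s by (auto simp: t_def)
      have "f0 x * exp (t * (p \<bullet> x)) = g0 x * exp (s * (- (p \<bullet> x)))" for x
        unfolding f0_eq t(3) by (simp add: algebra_simps exp_add[symmetric] exp_diff exp_minus field_simps)
      then have G4: "(\<integral>\<^sup>+x. ennreal (f0 x * exp (t * (p \<bullet> x))) \<partial>lborel)
          = ennreal (Z1 * (\<integral>x. exp (s * (- (p \<bullet> x))) \<partial>?\<nu>))"
        using G(4)[OF s] by simp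
      have "exp ((1 - t) * ln Z0 + t * ln Z1) = Z1 * exp (s * (- \<kappa>))"
      proof -
        have "(1 - t) * ln Z0 + t * ln Z1 = ln Z1 + s * (- \<kappa>)" by (simp add: \<kappa>_def t(3) algebra_simps)
        then show ?thesis using g0(3) by (simp only: exp_add exp_ln)
      qed
      then have "Z1 * (exp (s * (- \<kappa>)) * (1 + s * (1 - s) * (\<alpha> / 2 * D - (m1 - m0)))) \<le> Z1 * (\<integral>x. exp (s * (- (p \<bullet> x))) \<partial>?\<nu>)"
        using key[OF t(1,2) G4] g0(3) by (simp add: t(3) mult_ac)
      then show ?thesis using g0(3) by simp
    qed
    then have "- \<kappa> + (\<alpha> / 2 * D - (m1 - m0)) \<le> (\<integral>x. - (p \<bullet> x) \<partial>?\<nu>)"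
      using \<nu>p G(3) by (intro \<nu>.exponential_tilt_derivative_bound) auto
    then show ?thesis by (simp add: m1_def)
  qed
  have "\<alpha> * D \<le> m1 - m0" using 1 2 by (simp add: field_simps)
  also have "m1 - m0 = (\<integral>w. p \<bullet> snd w - p \<bullet> fst w \<partial>\<gamma>)" unfolding m using \<gamma>p by simp
  also have "\<dots> \<le> (\<integral>w. (norm p)\<^sup>2 / (2 * \<alpha>) + \<alpha> / 2 * (norm (fst w - snd w))\<^sup>2 \<partial>\<gamma>)"
  proof (rule integral_mono)
    fix w :: "'a \<times> 'a"
    let ?d = "norm (fst w - snd w)"
    have "p \<bullet> snd w - p \<bullet> fst w = p \<bullet> (snd w - fst w)" by (simp add: inner_diff_right)
    also have "\<dots> \<le> norm p * norm (snd w - fst w)" by (rule norm_cauchy_schwarz)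
    also have "\<dots> = norm p * ?d" by (simp add: norm_minus_commute)
    also have "\<dots> \<le> (norm p)\<^sup>2 / (2 * \<alpha>) + \<alpha> / 2 * ?d\<^sup>2"
    proof -
      have "0 \<le> (norm p - \<alpha> * ?d)\<^sup>2 / (2 * \<alpha>)" using \<alpha> by simp
      also have "\<dots> = (norm p)\<^sup>2 / (2 * \<alpha>) + \<alpha> / 2 * ?d\<^sup>2 - norm p * ?d"
        using \<alpha> by (simp add: power2_diff field_simps power2_eq_square)
      finally show ?thesis by simp
    qed
    finally show "p \<bullet> snd w - p \<bullet> fst w \<le> (norm p)\<^sup>2 / (2 * \<alpha>) + \<alpha> / 2 * ?d\<^sup>2" .
  qed (use \<gamma>p dist_int in auto)
  also have "\<dots> = (norm p)\<^sup>2 / (2 * \<alpha>) + \<alpha> / 2 * D"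
    unfolding D_def using dist_int by (simp add: \<gamma>.prob_space)
  finally have D: "D \<le> (norm p / \<alpha>)\<^sup>2"
    using \<alpha> by (simp add: field_simps power2_eq_square)
  have "\<gamma> \<in> couplings ?\<mu> ?\<nu>"
    unfolding couplings_def using \<gamma>.prob_space_axioms sets fst snd by simp
  then have "(INF \<gamma>\<in>couplings ?\<mu> ?\<nu>. \<integral>\<^sup>+(y, z). ennreal ((dist y z)\<^sup>2) \<partial>\<gamma>)
      \<le> (\<integral>\<^sup>+(y, z). ennreal ((dist y z)\<^sup>2) \<partial>\<gamma>)" by (rule INF_lower)
  also have "\<dots> = (\<integral>\<^sup>+w. ennreal ((norm (fst w - snd w))\<^sup>2) \<partial>\<gamma>)"
    by (simp add: split_beta' dist_norm)
  also have "\<dots> = ennreal D" unfolding D_def using dist_int by (intro nn_integral_eq_integral) auto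
  also have "\<dots> \<le> ennreal ((norm p / \<alpha>)\<^sup>2)" using D by (rule ennreal_leI)
  finally show ?thesis unfolding wasserstein2_def using \<alpha> by (intro ennreal_sqrt_le) auto
qed

section \<open>Differentiating the log-partition function\<close>

lemma exp_remainder_le: "\<bar>exp a - 1 - a\<bar> \<le> a\<^sup>2 * exp \<bar>a\<bar>" for a :: real
proof -
  have "1 + (- a) \<le> exp (- a)" by (rule exp_ge_add_one_self)
  then have "(1 - a) * exp a \<le> exp (- a) * exp a" by (intro mult_right_mono) auto
  then have "exp a - 1 \<le> a * exp a" by (simp add: algebra_simps flip: exp_add)
  then have 1: "exp a - 1 - a \<le> a * (exp a - 1)" by (simp add: algebra_simps)
  have 2: "0 \<le> exp a - 1 - a" using exp_ge_add_one_self[of a] by linarith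
  have "a * (exp a - 1) \<le> a\<^sup>2 * exp \<bar>a\<bar>"
  proof (cases "a \<ge> 0")
    case True
    then have "a * (exp a - 1) \<le> a * (a * exp a)"
      using \<open>exp a - 1 \<le> a * exp a\<close> by (rule mult_left_mono[rotated])
    then show ?thesis using True by (simp add: power2_eq_square mult.assoc)
  next
    case False
    have "1 - exp a \<le> - a" using exp_ge_add_one_self[of a] by linarith
    then have "(- a) * (1 - exp a) \<le> (- a) * (- a)" using False by (intro mult_left_mono) auto
    also have "\<dots> \<le> a\<^sup>2 * exp \<bar>a\<bar>"
      using mult_left_mono[of 1 "exp \<bar>a\<bar>" "a\<^sup>2"] by (simp add: power2_eq_square)
    finally show ?thesis by (simp add: algebra_simps)
  qed
  then show ?thesis using 1 2 by simp
qed

text \<open>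
  The second derivative is only asked to exist in each fixed direction \<open>v\<close>, which is what a
  second derivative along a line requires.
\<close>

definition twice_differentiable_on :: "'a::real_normed_vector set \<Rightarrow> ('a \<Rightarrow> real) \<Rightarrow> ('a \<Rightarrow> 'a \<Rightarrow> real) \<Rightarrow> bool" where
  "twice_differentiable_on S f G \<longleftrightarrow>
     (\<forall>x\<in>S. (f has_derivative G x) (at x) \<and> (\<forall>v. (\<lambda>y. G y v) differentiable (at x)))"

text \<open>
  The base measure \<open>N\<close> absorbs the density \<open>h\<close>; \<open>S\<close> is the sufficient statistic.
\<close>

locale exponential_family =
  fixes N :: "'a measure" and S :: "'a \<Rightarrow> 'd::euclidean_space"
  assumes S[measurable]: "S \<in> borel_measurable N"
begin

definition domain :: "'d set" where
  "domain = {\<theta>. integrable N (\<lambda>x. exp (S x \<bullet> \<theta>))}"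

text \<open>
  The weights that arise by differentiating under the integral sign are products of linear
  functions of \<open>S\<close>.  This class contains the constants, is stable under multiplication by such
  functions, and keeps the integrals finite in the interior of the domain.
\<close>

definition subexponential :: "('a \<Rightarrow> real) \<Rightarrow> bool" where
  "subexponential w \<longleftrightarrow> w \<in> borel_measurable N \<and>
     (\<forall>r>0. \<exists>C\<ge>0. \<forall>x\<in>space N. \<bar>w x\<bar> \<le> C * exp (r * norm (S x)))"

definition weighted_mgf :: "('a \<Rightarrow> real) \<Rightarrow> 'd \<Rightarrow> real" where
  "weighted_mgf w \<theta> = (\<integral>x. w x * exp (S x \<bullet> \<theta>) \<partial>N)"

lemma convex_domain: "convex domain"
  unfolding convex_alt
proof (intro ballI allI impI)
  fix a b :: 'd and u :: real
  assume ab: "a \<in> domain" "b \<in> domain" and u: "0 \<le> u \<and> u \<le> 1"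
  have "integrable N (\<lambda>x. exp (S x \<bullet> ((1 - u) *\<^sub>R a + u *\<^sub>R b)))"
  proof (rule Bochner_Integration.integrable_bound)
    show "integrable N (\<lambda>x. (1 - u) * exp (S x \<bullet> a) + u * exp (S x \<bullet> b))"
      using ab by (simp add: domain_def)
    show "AE x in N. norm (exp (S x \<bullet> ((1 - u) *\<^sub>R a + u *\<^sub>R b))) \<le> norm ((1 - u) * exp (S x \<bullet> a) + u * exp (S x \<bullet> b))"
    proof (rule AE_I2)
      fix x
      have "exp ((1 - u) *\<^sub>R (S x \<bullet> a) + u *\<^sub>R (S x \<bullet> b)) \<le> (1 - u) * exp (S x \<bullet> a) + u * exp (S x \<bullet> b)"
        using u by (intro convex_onD[OF exp_convex]) auto
      then show "norm (exp (S x \<bullet> ((1 - u) *\<^sub>R a + u *\<^sub>R b))) \<le> norm ((1 - u) * exp (S x \<bullet> a) + u * exp (S x \<bullet> b))"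
        by (simp add: inner_add_right)
    qed
  qed measurable
  then show "(1 - u) *\<^sub>R a + u *\<^sub>R b \<in> domain" by (simp add: domain_def)
qed

lemma subexponential_const: "subexponential (\<lambda>_. c)"
  unfolding subexponential_def
proof (intro conjI allI impI)
  fix r :: real assume "r > 0"
  then show "\<exists>C\<ge>0. \<forall>x\<in>space N. \<bar>c\<bar> \<le> C * exp (r * norm (S x))"
    by (intro exI[of _ "\<bar>c\<bar>"]) (auto intro!: mult_le_cancel_left1[THEN iffD2])
qed simp

lemma subexponential_mult_inner:
  assumes "subexponential w"
  shows "subexponential (\<lambda>x. w x * (S x \<bullet> v))"
  unfolding subexponential_def
proof (intro conjI allI impI)
  have [measurable]: "w \<in> borel_measurable N" using assms by (simp add: subexponential_def)
  show "(\<lambda>x. w x * (S x \<bullet> v)) \<in> borel_measurable N" by measurable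
  fix r :: real assume r: "r > 0"
  then obtain C where C: "C \<ge> 0" "\<And>x. x \<in> space N \<Longrightarrow> \<bar>w x\<bar> \<le> C * exp (r / 2 * norm (S x))"
    using assms unfolding subexponential_def by (meson half_gt_zero)
  have "\<bar>w x * (S x \<bullet> v)\<bar> \<le> (C * (2 / r * norm v)) * exp (r * norm (S x))" if "x \<in> space N" for x
  proof -
    have "r / 2 * norm (S x) \<le> exp (r / 2 * norm (S x))"
      using exp_ge_add_one_self[of "r / 2 * norm (S x)"] by linarith
    then have "norm (S x) \<le> 2 / r * exp (r / 2 * norm (S x))" using r by (simp add: field_simps)
    moreover have "\<bar>S x \<bullet> v\<bar> \<le> norm (S x) * norm v" by (rule Cauchy_Schwarz_ineq2)
    ultimately have "\<bar>S x \<bullet> v\<bar> \<le> (2 / r * exp (r / 2 * norm (S x))) * norm v"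
      by (meson mult_right_mono norm_ge_zero order_trans)
    then have "\<bar>w x\<bar> * \<bar>S x \<bullet> v\<bar> \<le> (C * exp (r / 2 * norm (S x))) * ((2 / r * exp (r / 2 * norm (S x))) * norm v)"
      using C that by (intro mult_mono) auto
    also have "\<dots> = (C * (2 / r * norm v)) * exp (r / 2 * norm (S x) + r / 2 * norm (S x))"
      unfolding exp_add by (simp only: mult_ac)
    also have "r / 2 * norm (S x) + r / 2 * norm (S x) = r * norm (S x)" by simp
    finally show ?thesis by (simp add: abs_mult)
  qed
  then show "\<exists>C\<ge>0. \<forall>x\<in>space N. \<bar>w x * (S x \<bullet> v)\<bar> \<le> C * exp (r * norm (S x))"
    using C r by (intro exI[of _ "C * (2 / r * norm v)"]) auto
qed

text \<open>
  If \<open>S \<bullet> b\<close> is the largest coordinate of \<open>S\<close> in absolute value, then \<open>norm S \<le> DIM * |S \<bullet> b|\<close>; hence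
  \<open>exp (r * norm S)\<close> is dominated by the sum of the exponentials at the finitely many points
  \<open>\<theta> \<plusminus> (r * DIM) b\<close>, which belong to the domain for small \<open>r\<close>.
\<close>

lemma integrable_exp_norm:
  assumes "\<theta> \<in> interior domain"
  obtains r where "r > 0" "integrable N (\<lambda>x. exp (S x \<bullet> \<theta> + r * norm (S x)))"
proof -
  obtain e where e: "e > 0" "ball \<theta> e \<subseteq> domain" using assms by (auto simp: mem_interior)
  let ?d = "real DIM('d)"
  define r where "r = e / (2 * ?d)"
  have r: "r > 0" using e by (simp add: r_def)
  have rd: "r * ?d = e / 2" by (simp add: r_def)
  let ?B = "\<lambda>x. \<Sum>b\<in>Basis. exp (S x \<bullet> (\<theta> + (r * ?d) *\<^sub>R b)) + exp (S x \<bullet> (\<theta> - (r * ?d) *\<^sub>R b))"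
  have "integrable N (\<lambda>x. exp (S x \<bullet> \<theta> + r * norm (S x)))"
  proof (rule Bochner_Integration.integrable_bound)
    have "\<theta> + (r * ?d) *\<^sub>R b \<in> domain" "\<theta> - (r * ?d) *\<^sub>R b \<in> domain" if "b \<in> Basis" for b
      using that e unfolding rd by (auto simp: dist_norm)
    then show "integrable N ?B"
      by (intro Bochner_Integration.integrable_sum Bochner_Integration.integrable_add) (auto simp: domain_def)
    show "AE x in N. norm (exp (S x \<bullet> \<theta> + r * norm (S x))) \<le> norm (?B x)"
    proof (rule AE_I2)
      fix x
      let ?m = "Max ((\<lambda>b. \<bar>S x \<bullet> b\<bar>) ` Basis)"
      have "?m \<in> (\<lambda>b. \<bar>S x \<bullet> b\<bar>) ` Basis" by (intro Max_in) auto
      then obtain b where b: "?m = \<bar>S x \<bullet> b\<bar>" "b \<in> Basis" by (rule imageE)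
      have "norm (S x) \<le> (\<Sum>b\<in>Basis. \<bar>S x \<bullet> b\<bar>)" by (rule norm_le_l1)
      also have "\<dots> \<le> ?d * ?m" by (intro sum_bounded_above) auto
      finally have "r * norm (S x) \<le> r * (?d * \<bar>S x \<bullet> b\<bar>)" using b r by simp
      then have "exp (S x \<bullet> \<theta> + r * norm (S x)) \<le> exp (S x \<bullet> \<theta> + (r * ?d) * \<bar>S x \<bullet> b\<bar>)"
        by (simp add: mult.assoc)
      also have "\<dots> \<le> exp (S x \<bullet> (\<theta> + (r * ?d) *\<^sub>R b)) + exp (S x \<bullet> (\<theta> - (r * ?d) *\<^sub>R b))"
        by (cases "S x \<bullet> b \<ge> 0") (auto simp: inner_add_right inner_diff_right)
      also have "\<dots> \<le> ?B x"
        using b(2) by (intro member_le_sum) (auto intro: add_nonneg_nonneg)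
      finally show "norm (exp (S x \<bullet> \<theta> + r * norm (S x))) \<le> norm (?B x)" by simp
    qed
  qed measurable
  with r show ?thesis using that by blast
qed

lemma integrable_subexponential:
  assumes \<theta>: "\<theta> \<in> interior domain" and w: "subexponential w"
  obtains r where "r > 0" "integrable N (\<lambda>x. \<bar>w x\<bar> * exp (S x \<bullet> \<theta> + r * norm (S x)))"
proof -
  have [measurable]: "w \<in> borel_measurable N" using w by (simp add: subexponential_def)
  obtain r0 where r0: "r0 > 0" "integrable N (\<lambda>x. exp (S x \<bullet> \<theta> + r0 * norm (S x)))"
    using integrable_exp_norm[OF \<theta>] .
  define r where "r = r0 / 2"
  have r: "r > 0" using r0 by (simp add: r_def)
  obtain C where C: "C \<ge> 0" "\<And>x. x \<in> space N \<Longrightarrow> \<bar>w x\<bar> \<le> C * exp (r * norm (S x))"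
    using w r unfolding subexponential_def by meson
  have "integrable N (\<lambda>x. \<bar>w x\<bar> * exp (S x \<bullet> \<theta> + r * norm (S x)))"
  proof (rule Bochner_Integration.integrable_bound)
    show "integrable N (\<lambda>x. C * exp (S x \<bullet> \<theta> + r0 * norm (S x)))" using r0 by simp
    show "AE x in N. norm (\<bar>w x\<bar> * exp (S x \<bullet> \<theta> + r * norm (S x))) \<le> norm (C * exp (S x \<bullet> \<theta> + r0 * norm (S x)))"
    proof (rule AE_I2)
      fix x assume "x \<in> space N"
      then have "\<bar>w x\<bar> * exp (S x \<bullet> \<theta> + r * norm (S x)) \<le> C * exp (r * norm (S x)) * exp (S x \<bullet> \<theta> + r * norm (S x))"
        by (intro mult_right_mono C) auto
      also have "\<dots> = C * exp (S x \<bullet> \<theta> + r0 * norm (S x))"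
        by (simp add: r_def exp_add[symmetric] mult.assoc)
      finally show "norm (\<bar>w x\<bar> * exp (S x \<bullet> \<theta> + r * norm (S x))) \<le> norm (C * exp (S x \<bullet> \<theta> + r0 * norm (S x)))"
        using C by simp
    qed
  qed measurable
  with r show ?thesis using that by blast
qed

lemma integrable_weighted_near:
  assumes r: "integrable N (\<lambda>x. \<bar>w x\<bar> * exp (S x \<bullet> \<theta> + r * norm (S x)))"
    and [measurable]: "w \<in> borel_measurable N" and v: "norm v \<le> r"
  shows "integrable N (\<lambda>x. w x * exp (S x \<bullet> (\<theta> + v)))"
proof (rule Bochner_Integration.integrable_bound[OF r])
  show "AE x in N. norm (w x * exp (S x \<bullet> (\<theta> + v))) \<le> norm (\<bar>w x\<bar> * exp (S x \<bullet> \<theta> + r * norm (S x)))"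
  proof (rule AE_I2)
    fix x
    have "S x \<bullet> v \<le> norm (S x) * norm v" by (rule norm_cauchy_schwarz)
    also have "\<dots> \<le> r * norm (S x)" using v by (simp add: mult.commute mult_right_mono)
    finally have "exp (S x \<bullet> (\<theta> + v)) \<le> exp (S x \<bullet> \<theta> + r * norm (S x))" by (simp add: inner_add_right)
    then show "norm (w x * exp (S x \<bullet> (\<theta> + v))) \<le> norm (\<bar>w x\<bar> * exp (S x \<bullet> \<theta> + r * norm (S x)))"
      by (simp add: abs_mult mult_left_mono)
  qed
qed measurable

lemma integrable_weighted:
  assumes \<theta>: "\<theta> \<in> interior domain" and w: "subexponential w"
  shows "integrable N (\<lambda>x. w x * exp (S x \<bullet> \<theta>))"
proof -
  obtain r where r: "r > 0" "integrable N (\<lambda>x. \<bar>w x\<bar> * exp (S x \<bullet> \<theta> + r * norm (S x)))"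
    using integrable_subexponential[OF \<theta> w] .
  have "w \<in> borel_measurable N" using w by (simp add: subexponential_def)
  from integrable_weighted_near[OF r(2) this, of 0] r(1) show ?thesis by simp
qed

text \<open>
  The remainder \<open>exp a - 1 - a\<close> with \<open>a = S \<bullet> v\<close> is at most \<open>a^2 exp |a|\<close>, and for \<open>norm v < r / 2\<close>
  its integral is at most a constant times \<open>(norm v)^2\<close>: the factor \<open>(norm S)^2\<close> costs half of the
  exponential moment of order \<open>r\<close>, the factor \<open>exp |a|\<close> the other half.
\<close>

lemma has_derivative_weighted_mgf:
  assumes \<theta>: "\<theta> \<in> interior domain" and w: "subexponential w"
  shows "(weighted_mgf w has_derivative (\<lambda>v. weighted_mgf (\<lambda>x. w x * (S x \<bullet> v)) \<theta>)) (at \<theta>)"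
proof -
  have [measurable]: "w \<in> borel_measurable N" using w by (simp add: subexponential_def)
  obtain r where r: "r > 0" and int: "integrable N (\<lambda>x. \<bar>w x\<bar> * exp (S x \<bullet> \<theta> + r * norm (S x)))"
    using integrable_subexponential[OF \<theta> w] .
  let ?L = "\<lambda>v. weighted_mgf (\<lambda>x. w x * (S x \<bullet> v)) \<theta>"
  have Lint: "integrable N (\<lambda>x. w x * (S x \<bullet> v) * exp (S x \<bullet> \<theta>))" for v
    by (rule integrable_weighted[OF \<theta> subexponential_mult_inner[OF w]])
  have "linear ?L"
  proof (rule linearI)
    show "?L (u + v) = ?L u + ?L v" for u v
      unfolding weighted_mgf_def
      by (subst Bochner_Integration.integral_add[OF Lint Lint, symmetric]) (simp add: inner_add_right algebra_simps)
    show "?L (c *\<^sub>R v) = c *\<^sub>R ?L v" for c v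
      unfolding weighted_mgf_def by (simp add: mult_ac flip: integral_mult_right_zero)
  qed
  then have bl: "bounded_linear ?L" by (simp add: linear_conv_bounded_linear)
  define K where "K = (4 / r)\<^sup>2 * (\<integral>x. \<bar>w x\<bar> * exp (S x \<bullet> \<theta> + r * norm (S x)) \<partial>N)"
  show ?thesis
  proof (rule has_derivativeI_sandwich[where e = "r / 2" and H = "\<lambda>y. K * norm (y - \<theta>)"])
    show "bounded_linear ?L" by (rule bl)
    show "0 < r / 2" using r by simp
    have "((\<lambda>y. K * norm (y - \<theta>)) \<longlongrightarrow> K * norm (\<theta> - \<theta>)) (at \<theta>)" by (intro tendsto_intros)
    then show "((\<lambda>y. K * norm (y - \<theta>)) \<longlongrightarrow> 0) (at \<theta>)" by simp
    fix y :: 'd assume y: "y \<noteq> \<theta>" "dist y \<theta> < r / 2"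
    define v where "v = y - \<theta>"
    have v: "v \<noteq> 0" "norm v < r / 2" "y = \<theta> + v" using y by (auto simp: v_def dist_norm)
    have i1: "integrable N (\<lambda>x. w x * exp (S x \<bullet> (\<theta> + v)))"
      using v r by (intro integrable_weighted_near[OF int]) auto
    have i0: "integrable N (\<lambda>x. w x * exp (S x \<bullet> \<theta>))" by (rule integrable_weighted[OF \<theta> w])
    have eq: "weighted_mgf w y - weighted_mgf w \<theta> - ?L (y - \<theta>)
        = (\<integral>x. w x * exp (S x \<bullet> \<theta>) * (exp (S x \<bullet> v) - 1 - S x \<bullet> v) \<partial>N)"
      unfolding weighted_mgf_def v(3) using i0 i1 Lint[of v]
      by (simp add: Bochner_Integration.integral_diff[symmetric] inner_add_right exp_add algebra_simps
           del: Bochner_Integration.integral_diff)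
    have "norm (weighted_mgf w y - weighted_mgf w \<theta> - ?L (y - \<theta>))
       \<le> (\<integral>x. ((norm v)\<^sup>2 * (4 / r)\<^sup>2) * (\<bar>w x\<bar> * exp (S x \<bullet> \<theta> + r * norm (S x))) \<partial>N)"
      unfolding eq
    proof (rule order_trans[OF integral_norm_bound integral_mono])
      have "integrable N (\<lambda>x. w x * exp (S x \<bullet> (\<theta> + v)) - w x * exp (S x \<bullet> \<theta>) - w x * (S x \<bullet> v) * exp (S x \<bullet> \<theta>))"
        using i0 i1 Lint[of v] by simp
      then have "integrable N (\<lambda>x. w x * exp (S x \<bullet> \<theta>) * (exp (S x \<bullet> v) - 1 - S x \<bullet> v))"
        by (simp add: inner_add_right exp_add algebra_simps)
      then show "integrable N (\<lambda>x. norm (w x * exp (S x \<bullet> \<theta>) * (exp (S x \<bullet> v) - 1 - S x \<bullet> v)))"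
        by (rule integrable_norm)
      show "integrable N (\<lambda>x. ((norm v)\<^sup>2 * (4 / r)\<^sup>2) * (\<bar>w x\<bar> * exp (S x \<bullet> \<theta> + r * norm (S x))))"
        using int by simp
      fix x
      let ?a = "S x \<bullet> v" and ?n = "norm (S x)"
      have a: "\<bar>?a\<bar> \<le> ?n * norm v" by (rule Cauchy_Schwarz_ineq2)
      have ar: "\<bar>?a\<bar> \<le> r / 2 * ?n"
        using a v(2) mult_left_mono[of "norm v" "r / 2" ?n] by (simp add: mult.commute)
      have "?a\<^sup>2 \<le> (?n * norm v)\<^sup>2" using a by (metis abs_ge_zero power2_abs power_mono)
      have "r / 4 * ?n \<le> exp (r / 4 * ?n)" using exp_ge_add_one_self[of "r / 4 * ?n"] by linarith
      then have "?n \<le> 4 / r * exp (r / 4 * ?n)" using r by (simp add: field_simps)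
      then have "?n\<^sup>2 \<le> (4 / r * exp (r / 4 * ?n))\<^sup>2" by (intro power_mono) auto
      also have "\<dots> = (4 / r)\<^sup>2 * exp (r / 2 * ?n)"
        by (simp add: power_mult_distrib power2_eq_square exp_add[symmetric])
      finally have n2: "?n\<^sup>2 \<le> (4 / r)\<^sup>2 * exp (r / 2 * ?n)" .
      have "\<bar>exp ?a - 1 - ?a\<bar> \<le> ?a\<^sup>2 * exp \<bar>?a\<bar>" by (rule exp_remainder_le)
      also have "\<dots> \<le> (?n * norm v)\<^sup>2 * exp (r / 2 * ?n)"
        using ar \<open>?a\<^sup>2 \<le> _\<close> by (intro mult_mono) auto
      also have "\<dots> = (norm v)\<^sup>2 * (?n\<^sup>2 * exp (r / 2 * ?n))" by (simp add: power_mult_distrib mult_ac)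
      also have "\<dots> \<le> (norm v)\<^sup>2 * (((4 / r)\<^sup>2 * exp (r / 2 * ?n)) * exp (r / 2 * ?n))"
        using n2 by (intro mult_left_mono mult_right_mono) auto
      also have "\<dots> = ((norm v)\<^sup>2 * (4 / r)\<^sup>2) * exp (r / 2 * ?n + r / 2 * ?n)"
        unfolding exp_add by (simp only: mult_ac)
      also have "r / 2 * ?n + r / 2 * ?n = r * ?n" by simp
      finally have rem: "\<bar>exp ?a - 1 - ?a\<bar> \<le> ((norm v)\<^sup>2 * (4 / r)\<^sup>2) * exp (r * ?n)" .
      have "norm (w x * exp (S x \<bullet> \<theta>) * (exp ?a - 1 - ?a)) = (\<bar>w x\<bar> * exp (S x \<bullet> \<theta>)) * \<bar>exp ?a - 1 - ?a\<bar>"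
        by (simp add: abs_mult)
      also have "\<dots> \<le> (\<bar>w x\<bar> * exp (S x \<bullet> \<theta>)) * (((norm v)\<^sup>2 * (4 / r)\<^sup>2) * exp (r * ?n))"
        using rem by (intro mult_left_mono) auto
      also have "\<dots> = ((norm v)\<^sup>2 * (4 / r)\<^sup>2) * (\<bar>w x\<bar> * exp (S x \<bullet> \<theta> + r * ?n))"
        unfolding exp_add by (simp only: mult_ac)
      finally show "norm (w x * exp (S x \<bullet> \<theta>) * (exp ?a - 1 - ?a))
          \<le> ((norm v)\<^sup>2 * (4 / r)\<^sup>2) * (\<bar>w x\<bar> * exp (S x \<bullet> \<theta> + r * ?n))" .
    qed
    also have "\<dots> = K * norm v * norm v"
      unfolding K_def integral_mult_right_zero by (simp only: power2_eq_square mult_ac)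
    finally show "norm (weighted_mgf w y - weighted_mgf w \<theta> - ?L (y - \<theta>)) / norm (y - \<theta>) \<le> K * norm (y - \<theta>)"
      using v(1) by (simp add: v_def[symmetric] field_simps)
  qed
qed

lemma weighted_mgf_one_pos:
  assumes \<theta>: "\<theta> \<in> domain" and N: "emeasure N (space N) \<noteq> 0"
  shows "weighted_mgf (\<lambda>_. 1) \<theta> > 0"
proof -
  have int: "integrable N (\<lambda>x. exp (S x \<bullet> \<theta>))" using \<theta> by (simp add: domain_def)
  have "(\<integral>x. exp (S x \<bullet> \<theta>) \<partial>N) \<noteq> 0"
  proof
    assume "(\<integral>x. exp (S x \<bullet> \<theta>) \<partial>N) = 0"
    then have "AE x in N. exp (S x \<bullet> \<theta>) = 0"
      by (subst (asm) integral_nonneg_eq_0_iff_AE[OF int]) auto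
    then have "AE x in N. False" by simp
    then show False using N by (simp add: AE_iff_measurable[of "space N"])
  qed
  moreover have "(\<integral>x. exp (S x \<bullet> \<theta>) \<partial>N) \<ge> 0" by (intro integral_nonneg_AE) auto
  ultimately have "(\<integral>x. exp (S x \<bullet> \<theta>) \<partial>N) > 0" by linarith
  then show ?thesis by (simp add: weighted_mgf_def)
qed

lemma twice_differentiable_log_mgf:
  assumes "open domain" and N: "emeasure N (space N) \<noteq> 0"
  shows "twice_differentiable_on domain (\<lambda>\<theta>. ln (weighted_mgf (\<lambda>_. 1) \<theta>))
     (\<lambda>\<theta> v. weighted_mgf (\<lambda>x. S x \<bullet> v) \<theta> / weighted_mgf (\<lambda>_. 1) \<theta>)"
  unfolding twice_differentiable_on_def
proof (intro ballI conjI allI)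
  fix \<theta> v assume \<theta>: "\<theta> \<in> domain"
  then have int: "\<theta> \<in> interior domain" using assms by (simp add: interior_open)
  have pos: "weighted_mgf (\<lambda>_. 1) \<theta> > 0" using weighted_mgf_one_pos[OF \<theta> N] .
  have F: "(weighted_mgf (\<lambda>_. 1) has_derivative (\<lambda>v. weighted_mgf (\<lambda>x. S x \<bullet> v) \<theta>)) (at \<theta>)"
    using has_derivative_weighted_mgf[OF int subexponential_const[of 1]] by simp
  show "((\<lambda>\<theta>. ln (weighted_mgf (\<lambda>_. 1) \<theta>)) has_derivative
     (\<lambda>v. weighted_mgf (\<lambda>x. S x \<bullet> v) \<theta> / weighted_mgf (\<lambda>_. 1) \<theta>)) (at \<theta>)"
    using has_derivative_ln[OF pos F] by (simp add: divide_inverse mult.commute)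
  have "subexponential (\<lambda>x. S x \<bullet> v)"
    using subexponential_mult_inner[OF subexponential_const[of 1]] by simp
  then have "weighted_mgf (\<lambda>x. S x \<bullet> v) differentiable (at \<theta>)"
    using has_derivative_weighted_mgf[OF int] by (auto simp: differentiable_def)
  moreover have "weighted_mgf (\<lambda>_. 1) differentiable (at \<theta>)"
    using F by (auto simp: differentiable_def)
  ultimately show "(\<lambda>y. weighted_mgf (\<lambda>x. S x \<bullet> v) y / weighted_mgf (\<lambda>_. 1) y) differentiable (at \<theta>)"
    using pos by (intro differentiable_divide) auto
qed

end

section \<open>Strong convexity from the Hessian\<close>

lemma twice_differentiable_onD:
  assumes "twice_differentiable_on S f G" "x \<in> S"
  shows "(f has_derivative G x) (at x)" "(\<lambda>y. G y v) differentiable (at x)"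
  using assms by (auto simp: twice_differentiable_on_def)

lemma twice_differentiable_on_add:
  assumes "twice_differentiable_on S f F" "twice_differentiable_on S g G"
  shows "twice_differentiable_on S (\<lambda>x. f x + g x) (\<lambda>x v. F x v + G x v)"
  using assms unfolding twice_differentiable_on_def
  by (auto intro!: has_derivative_add differentiable_add)

lemma C2_on_imp_twice_differentiable_on:
  assumes "C2_on S f"
  obtains G where "twice_differentiable_on S f G"
proof -
  obtain f' f'' where *: "\<And>x. x \<in> S \<Longrightarrow> (f has_derivative blinfun_apply (f' x)) (at x)"
    "\<And>x. x \<in> S \<Longrightarrow> (f' has_derivative blinfun_apply (f'' x)) (at x)"
    using assms unfolding C2_on_def by blast
  have "(\<lambda>y. blinfun_apply (f' y) v) differentiable (at x)" if "x \<in> S" for x v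
    using bounded_linear.has_derivative[OF blinfun.bounded_linear_left *(2)[OF that]]
    by (auto simp: differentiable_def)
  with * have "twice_differentiable_on S f (\<lambda>x. blinfun_apply (f' x))"
    by (auto simp: twice_differentiable_on_def)
  then show ?thesis by (rule that)
qed

lemma twice_differentiable_on_imp_continuous_on:
  assumes "twice_differentiable_on S f G"
  shows "continuous_on S f"
  using assms unfolding twice_differentiable_on_def
  by (meson continuous_at_imp_continuous_on has_derivative_continuous)

lemma has_real_derivative_along_line:
  fixes f :: "'a::real_normed_vector \<Rightarrow> real"
  assumes "(f has_derivative f') (at (x + s *\<^sub>R d))"
  shows "((\<lambda>s. f (x + s *\<^sub>R d)) has_real_derivative f' d) (at s)"
proof -
  have "((\<lambda>s. x + s *\<^sub>R d) has_derivative (\<lambda>h. h *\<^sub>R d)) (at s)"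
    by (auto intro!: derivative_eq_intros)
  from has_derivative_compose[OF this assms]
  have "((\<lambda>s. f (x + s *\<^sub>R d)) has_derivative (\<lambda>h. f' (h *\<^sub>R d))) (at s)" .
  moreover have "f' (h *\<^sub>R d) = f' d * h" for h
    using linear_scale[OF has_derivative_linear[OF assms]] by simp
  ultimately show ?thesis by (simp add: has_field_derivative_def)
qed

lemma linear_axis_sum:
  fixes L :: "real ^ 'n \<Rightarrow> real"
  assumes "linear L"
  shows "L v = (\<Sum>i\<in>UNIV. v $ i * L (axis i 1))"
proof -
  have "L v = L (\<Sum>i\<in>UNIV. v $ i *\<^sub>R axis i 1)"
    using basis_expansion[of v] by (simp add: scalar_mult_eq_scaleR)
  also have "\<dots> = (\<Sum>i\<in>UNIV. v $ i * L (axis i 1))"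
    using assms by (simp add: linear_sum linear_scale)
  finally show ?thesis .
qed

lemma hess_entry:
  fixes f :: "real ^ 'n \<Rightarrow> real"
  assumes S: "open S" "x \<in> S" and f: "twice_differentiable_on S f G"
    and H: "((\<lambda>y. G y (axis j 1)) has_derivative H) (at x)"
  shows "hess f x $ i $ j = H (axis i 1)"
proof -
  have first: "partial_deriv j f y = G y (axis j 1)" if "y \<in> S" for y
    unfolding partial_deriv_def
    by (rule DERIV_imp_deriv, rule has_real_derivative_along_line)
       (use twice_differentiable_onD(1)[OF f that] in simp)
  have "((\<lambda>t::real. x + t *\<^sub>R axis i 1) \<longlongrightarrow> x + 0 *\<^sub>R axis i 1) (nhds 0)"
    by (intro tendsto_intros filterlim_ident)
  then have "((\<lambda>t::real. x + t *\<^sub>R axis i 1) \<longlongrightarrow> x) (nhds 0)" by simp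
  then have "eventually (\<lambda>t::real. x + t *\<^sub>R axis i 1 \<in> S) (nhds 0)"
    using S by (rule topological_tendstoD)
  then have "eventually (\<lambda>t. partial_deriv j f (x + t *\<^sub>R axis i 1) = G (x + t *\<^sub>R axis i 1) (axis j 1)) (nhds 0)"
    by eventually_elim (rule first)
  then have "hess f x $ i $ j = deriv (\<lambda>t. G (x + t *\<^sub>R axis i 1) (axis j 1)) 0"
    unfolding hess_def by (simp add: partial_deriv_def[of i]) (rule deriv_cong_ev, auto)
  also have "\<dots> = H (axis i 1)"
    by (rule DERIV_imp_deriv, rule has_real_derivative_along_line) (use H in simp)
  finally show ?thesis .
qed

text \<open>
  Only the partial derivatives enter the matrix \<open>hess\<close>, so the derivative of the gradient in the
  direction \<open>d\<close> is expanded over the coordinate axes.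
\<close>

lemma second_derivative_along_line:
  fixes f :: "real ^ 'n \<Rightarrow> real"
  assumes S: "open S" and f: "twice_differentiable_on S f G" and x: "x + s *\<^sub>R d \<in> S"
  shows "((\<lambda>s. G (x + s *\<^sub>R d) d) has_real_derivative d \<bullet> (hess f (x + s *\<^sub>R d) *v d)) (at s)"
proof -
  let ?z = "x + s *\<^sub>R d"
  have "\<forall>j. \<exists>H. ((\<lambda>y. G y (axis j 1)) has_derivative H) (at ?z)"
    using twice_differentiable_onD(2)[OF f x] by (auto simp: differentiable_def)
  then obtain H where H: "\<And>j. ((\<lambda>y. G y (axis j 1)) has_derivative H j) (at ?z)" by metis
  have "((\<lambda>y. \<Sum>j\<in>UNIV. d $ j * G y (axis j 1)) has_derivative (\<lambda>u. \<Sum>j\<in>UNIV. d $ j * H j u)) (at ?z)"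
    by (intro has_derivative_sum has_derivative_mult_right H)
  then have "((\<lambda>y. G y d) has_derivative (\<lambda>u. \<Sum>j\<in>UNIV. d $ j * H j u)) (at ?z)"
  proof (rule has_derivative_transform_within_open[OF _ S x])
    fix y assume "y \<in> S"
    then have "linear (G y)" using has_derivative_linear[OF twice_differentiable_onD(1)[OF f]] by blast
    then show "(\<Sum>j\<in>UNIV. d $ j * G y (axis j 1)) = G y d" by (rule linear_axis_sum[symmetric])
  qed
  then have "((\<lambda>s. G (x + s *\<^sub>R d) d) has_real_derivative (\<Sum>j\<in>UNIV. d $ j * H j d)) (at s)"
    by (rule has_real_derivative_along_line)
  also have "(\<Sum>j\<in>UNIV. d $ j * H j d) = (\<Sum>j\<in>UNIV. d $ j * (\<Sum>i\<in>UNIV. d $ i * hess f ?z $ i $ j))"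
  proof (intro sum.cong refl)
    fix j
    have "H j d = (\<Sum>i\<in>UNIV. d $ i * H j (axis i 1))"
      by (rule linear_axis_sum[OF has_derivative_linear[OF H]])
    then show "d $ j * H j d = d $ j * (\<Sum>i\<in>UNIV. d $ i * hess f ?z $ i $ j)"
      by (simp add: hess_entry[OF S x f H])
  qed
  also have "\<dots> = (\<Sum>i\<in>UNIV. \<Sum>j\<in>UNIV. d $ j * (d $ i * hess f ?z $ i $ j))"
    unfolding sum_distrib_left by (rule sum.swap)
  also have "\<dots> = d \<bullet> (hess f ?z *v d)"
    by (simp add: inner_vec_def matrix_vector_mult_def sum_distrib_left mult_ac)
  finally show ?thesis .
qed

text \<open>
  Along the segment from \<open>x\<close> to \<open>y\<close>, subtracting \<open>\<alpha>/2 * (norm (x - y))^2 * s^2\<close> leaves a function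
  \<open>k\<close> of \<open>s\<close> with nonnegative second derivative; convexity of \<open>k\<close> and its tangent at \<open>0\<close> are the two
  claims.
\<close>

lemma
  fixes f :: "real ^ 'n \<Rightarrow> real"
  assumes S: "open S" "convex S" and f: "twice_differentiable_on S f G"
    and \<alpha>: "\<alpha> \<ge> 0"
    and hess: "\<And>x v. x \<in> S \<Longrightarrow> v \<bullet> (hess f x *v v) \<ge> \<alpha> * (v \<bullet> v)"
    and x: "x \<in> S" and y: "y \<in> S"
  shows strongly_convex_of_hess: "\<And>t. 0 < t \<Longrightarrow> t < 1 \<Longrightarrow> f ((1 - t) *\<^sub>R x + t *\<^sub>R y)
      \<le> (1 - t) * f x + t * f y - \<alpha> / 2 * t * (1 - t) * (norm (x - y))\<^sup>2"
    and above_tangent_of_hess: "f y \<ge> f x + G x (y - x)"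
proof -
  define d where "d = y - x"
  define k where "k = (\<lambda>s. f (x + s *\<^sub>R d) - \<alpha> / 2 * (d \<bullet> d) * s\<^sup>2)"
  define k' where "k' = (\<lambda>s. G (x + s *\<^sub>R d) d - \<alpha> * (d \<bullet> d) * s)"
  define k'' where "k'' = (\<lambda>s. d \<bullet> (hess f (x + s *\<^sub>R d) *v d) - \<alpha> * (d \<bullet> d))"
  have in_S: "x + s *\<^sub>R d \<in> S" if "s \<in> {0..1}" for s
  proof -
    have "x + s *\<^sub>R d = (1 - s) *\<^sub>R x + s *\<^sub>R y" by (simp add: d_def algebra_simps)
    then show ?thesis using convexD[OF S(2) x y, of "1 - s" s] that by simp
  qed
  have k1: "(k has_real_derivative k' s) (at s)" if "s \<in> {0..1}" for s
    unfolding k_def k'_def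
    by (rule derivative_eq_intros has_real_derivative_along_line twice_differentiable_onD(1)[OF f in_S[OF that]] refl | simp)+
  have k2: "(k' has_real_derivative k'' s) (at s)" if "s \<in> {0..1}" for s
    unfolding k'_def k''_def
    by (rule derivative_eq_intros second_derivative_along_line[OF S(1) f in_S[OF that]] refl | simp)+
  have k3: "k'' s \<ge> 0" if "s \<in> {0..1}" for s
    using hess[OF in_S[OF that]] by (simp add: k''_def)
  have conv: "convex_on {0..1} k"
    using k1 k2 k3 by (intro f''_ge0_imp_convex) auto
  have dd: "d \<bullet> d = (norm (x - y))\<^sup>2"
    by (simp add: d_def norm_minus_commute flip: power2_norm_eq_inner)
  show "f ((1 - t) *\<^sub>R x + t *\<^sub>R y) \<le> (1 - t) * f x + t * f y - \<alpha> / 2 * t * (1 - t) * (norm (x - y))\<^sup>2"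
    if t: "0 < t" "t < 1" for t
  proof -
    have "k ((1 - t) *\<^sub>R 0 + t *\<^sub>R 1) \<le> (1 - t) * k 0 + t * k 1"
      using t by (intro convex_onD[OF conv]) auto
    moreover have "x + t *\<^sub>R d = (1 - t) *\<^sub>R x + t *\<^sub>R y" by (simp add: d_def algebra_simps)
    ultimately have "f ((1 - t) *\<^sub>R x + t *\<^sub>R y) - \<alpha> / 2 * (d \<bullet> d) * t\<^sup>2
        \<le> (1 - t) * f x + t * (f y - \<alpha> / 2 * (d \<bullet> d))"
      by (simp add: k_def) (simp add: d_def)
    then show ?thesis unfolding dd by (simp add: algebra_simps power2_eq_square diff_divide_distrib)
  qed
  have "k' 0 * (1 - 0) \<le> k 1 - k 0"
    using k1 k2 k3 by (intro f''_imp_f'[where C = "{0..1}"]) auto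
  moreover have "\<alpha> * (d \<bullet> d) \<ge> 0" using \<alpha> by simp
  ultimately show "f y \<ge> f x + G x (y - x)"
    by (simp add: k_def k'_def d_def)
qed

lemma emeasure_lborel_open_pos:
  fixes S :: "'a::euclidean_space set"
  assumes "open S" "S \<noteq> {}"
  shows "emeasure lborel S \<noteq> 0"
proof
  assume "emeasure lborel S = 0"
  then have "S \<in> null_sets lborel" using assms by (auto intro: null_setsI)
  then have "negligible S" by (simp add: negligible_iff_null_sets null_sets_completionI)
  then show False using open_not_negligible assms by blast
qed

lemma dist_le_Lip:
  assumes "\<exists>L. L-lipschitz_on X T" "x \<in> X" "y \<in> X"
  shows "dist (T x) (T y) \<le> Lip X T * dist x y"
proof (cases "dist x y = 0")
  case False
  have "dist (T x) (T y) / dist x y \<le> Lip X T"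
    unfolding Lip_def
  proof (rule cInf_greatest)
    fix L assume "L \<in> {L. L-lipschitz_on X T}"
    then show "dist (T x) (T y) / dist x y \<le> L"
      using lipschitz_onD[of L X T x y] assms False by (simp add: divide_le_eq)
  qed (use assms in auto)
  then show ?thesis using False by (simp add: divide_le_eq)
qed (use assms in auto)

section \<open>Lipschitz dependence of the posterior on the data\<close>

theorem proposition2p4:
  fixes X :: "(real ^ 'm) set"
    and T :: "real ^ 'm \<Rightarrow> real ^ 'd"
    and h :: "real ^ 'm \<Rightarrow> real"
    and \<Theta> :: "(real ^ 'd) set"
    and M W :: "real ^ 'd \<Rightarrow> real"
    and \<pi> :: "(real ^ 'd) measure"
    and \<alpha> :: real
  assumes X: "X \<noteq> {}" "convex X" "open X"
    and T: "\<exists>L. L-lipschitz_on X T"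
    and h: "h \<in> borel_measurable (lebesgue_on X)" "\<And>x. x \<in> X \<Longrightarrow> h x > 0"
    and \<Theta>: "\<Theta> = natural_params X T h"
    and M: "M = log_partition X T h"
    and regular: "\<Theta> \<noteq> {}" "open \<Theta>"
      "interior (convex hull (measure_support (base_image X T h))) \<noteq> {}"
    and \<pi>: "\<pi> = prior \<Theta> W" "prob_space \<pi>"
    and W: "C2_on \<Theta> W"
    and \<alpha>: "\<alpha> > 0"
    and hess: "\<And>\<theta> v. \<theta> \<in> \<Theta> \<Longrightarrow>
      v \<bullet> (hess (\<lambda>\<theta>. M \<theta> + W \<theta>) \<theta> *v v) \<ge> \<alpha> * (v \<bullet> v)"
    and moment: "\<And>x. x \<in> X \<Longrightarrow>
      (\<integral>\<^sup>+ \<theta>\<in>\<Theta>. ennreal ((norm \<theta>)\<^sup>2 * exp (T x \<bullet> \<theta> - M \<theta> - W \<theta>)) \<partial>lborel) < \<infinity>"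
  shows "\<forall>x1\<in>X. \<forall>x2\<in>X.
    wasserstein2 (posterior \<pi> T M x1) (posterior \<pi> T M x2)
      \<le> ennreal (Lip X T / \<alpha> * norm (x1 - x2))"
proof (intro ballI)
  fix x1 x2 assume x12: "x1 \<in> X" "x2 \<in> X"
  have Xm: "X \<in> sets lebesgue" using X by (intro sets_completionI_sets) auto
  have contT: "continuous_on X T" using T lipschitz_on_continuous_on by blast
  have Tm[measurable]: "T \<in> borel_measurable (lebesgue_on X)"
    using contT Xm by (rule continuous_imp_measurable_on_sets_lebesgue)
  note [measurable] = h(1)
  define N where "N = density (lebesgue_on X) (\<lambda>x. ennreal (h x))"
  interpret E: exponential_family N T
    by standard (simp add: N_def)
  have domain: "E.domain = \<Theta>"
  proof -
    have "integrable N (\<lambda>x. exp (T x \<bullet> \<theta>)) \<longleftrightarrow> (\<integral>\<^sup>+ x. ennreal (exp (T x \<bullet> \<theta>) * h x) \<partial>lebesgue_on X) < \<infinity>" for \<theta>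
    proof -
      have "(\<integral>\<^sup>+x. ennreal (norm (exp (T x \<bullet> \<theta>))) \<partial>N) = (\<integral>\<^sup>+ x. ennreal (h x) * ennreal (exp (T x \<bullet> \<theta>)) \<partial>lebesgue_on X)"
        unfolding N_def by (subst nn_integral_density) auto
      also have "\<dots> = (\<integral>\<^sup>+ x. ennreal (exp (T x \<bullet> \<theta>) * h x) \<partial>lebesgue_on X)"
        using h(2) by (intro nn_integral_cong) (simp add: ennreal_mult'' mult.commute less_imp_le)
      moreover have "(\<lambda>x. exp (T x \<bullet> \<theta>)) \<in> borel_measurable N" by measurable
      ultimately show ?thesis by (simp add: integrable_iff_bounded)
    qed
    then show ?thesis unfolding \<Theta> natural_params_def E.domain_def by simp
  qed
  have N: "emeasure N (space N) \<noteq> 0"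
  proof
    assume "emeasure N (space N) = 0"
    have [measurable]: "X \<in> sets (lebesgue_on X)" by simp
    from \<open>emeasure N (space N) = 0\<close>
    have "(\<integral>\<^sup>+x. ennreal (h x) * indicator X x \<partial>lebesgue_on X) = 0"
      by (simp add: N_def emeasure_density)
    then have "AE x in lebesgue_on X. ennreal (h x) * indicator X x = 0"
      by (subst (asm) nn_integral_0_iff_AE) auto
    then have "AE x in lebesgue_on X. False"
      using AE_space[of "lebesgue_on X"] by eventually_elim (use h(2) in fastforce)
    then have "emeasure (lebesgue_on X) X = 0"
      by (simp add: AE_iff_measurable[of X])
    then have "emeasure lborel X = 0"
      using X Xm by (simp add: emeasure_restrict_space)
    then show False using emeasure_lborel_open_pos X by blast
  qed
  have M_eq: "M = (\<lambda>\<theta>. ln (E.weighted_mgf (\<lambda>_. 1) \<theta>))"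
  proof
    fix \<theta>
    have "E.weighted_mgf (\<lambda>_. 1) \<theta> = (\<integral>x. exp (T x \<bullet> \<theta>) \<partial>N)"
      by (simp add: E.weighted_mgf_def)
    also have "\<dots> = (\<integral>x. h x *\<^sub>R exp (T x \<bullet> \<theta>) \<partial>lebesgue_on X)"
      unfolding N_def by (subst integral_density) (auto intro!: AE_I2 less_imp_le h(2))
    finally show "M \<theta> = ln (E.weighted_mgf (\<lambda>_. 1) \<theta>)"
      by (simp add: M log_partition_def mult.commute)
  qed
  obtain GM where GM: "twice_differentiable_on \<Theta> M GM"
    using E.twice_differentiable_log_mgf[OF _ N] regular domain M_eq by blast
  obtain GW where GW: "twice_differentiable_on \<Theta> W GW"
    using C2_on_imp_twice_differentiable_on[OF W] .
  define U where "U = (\<lambda>\<theta>. M \<theta> + W \<theta>)"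
  define G where "G = (\<lambda>\<theta> v. GM \<theta> v + GW \<theta> v)"
  have G: "twice_differentiable_on \<Theta> U G"
    unfolding U_def G_def by (rule twice_differentiable_on_add[OF GM GW])
  have conv: "convex \<Theta>" using E.convex_domain domain by simp
  have hess_U: "v \<bullet> (hess U \<theta> *v v) \<ge> \<alpha> * (v \<bullet> v)" if "\<theta> \<in> \<Theta>" for \<theta> v
    unfolding U_def by (rule hess[OF that])
  have strong: "U ((1 - t) *\<^sub>R x + t *\<^sub>R y) \<le> (1 - t) * U x + t * U y - \<alpha> / 2 * t * (1 - t) * (norm (x - y))\<^sup>2"
    if "x \<in> \<Theta>" "y \<in> \<Theta>" "0 < t" "t < 1" for x y t
    using \<alpha> by (intro strongly_convex_of_hess[OF regular(2) conv G _ hess_U] that) auto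
  have tangent: "U y \<ge> U x + G x (y - x)" if "x \<in> \<Theta>" "y \<in> \<Theta>" for x y
    using \<alpha> by (intro above_tangent_of_hess[OF regular(2) conv G _ hess_U] that) auto
  have [measurable]: "\<Theta> \<in> sets borel" using regular by simp
  \<comment> \<open>Off \<open>\<Theta>\<close> the integral defining \<open>M\<close> diverges and has the default value 0, as has \<open>ln 0\<close>; this makes \<open>M\<close> measurable on the whole space.\<close>
  have M_off: "M \<theta> = 0" if "\<theta> \<notin> \<Theta>" for \<theta>
  proof -
    have "\<not> integrable N (\<lambda>x. exp (T x \<bullet> \<theta>))" using that domain by (auto simp: E.domain_def)
    then show ?thesis by (simp add: M_eq E.weighted_mgf_def not_integrable_integral_eq)
  qed
  have [measurable]: "M \<in> borel_measurable borel"
  proof -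
    have "(\<lambda>\<theta>. if \<theta> \<in> \<Theta> then M \<theta> else 0) \<in> borel_measurable borel"
      using twice_differentiable_on_imp_continuous_on[OF GM]
      by (intro borel_measurable_continuous_on_if) auto
    also have "(\<lambda>\<theta>. if \<theta> \<in> \<Theta> then M \<theta> else 0) = M" using M_off by auto
    finally show ?thesis .
  qed
  define w where "w = (\<lambda>\<theta>. if \<theta> \<in> \<Theta> then exp (- W \<theta>) else 0)"
  have [measurable]: "w \<in> borel_measurable borel"
    unfolding w_def using twice_differentiable_on_imp_continuous_on[OF GW]
    by (intro borel_measurable_continuous_on_if continuous_intros) auto
  have w_nn: "w \<theta> \<ge> 0" for \<theta> by (simp add: w_def)
  have \<pi>_eq: "\<pi> = density lborel (\<lambda>\<theta>. ennreal (w \<theta>))"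
    unfolding \<pi> prior_def by (intro arg_cong[where f = "density lborel"]) (auto simp: w_def fun_eq_iff)
  define F where "F = (\<lambda>x \<theta>. w \<theta> * exp (T x \<bullet> \<theta> - M \<theta>))"
  have [measurable]: "F x \<in> borel_measurable borel" for x unfolding F_def by measurable
  have F_nn: "F x \<theta> \<ge> 0" for x \<theta> by (simp add: F_def w_def)
  have F_in: "F x \<theta> = exp (T x \<bullet> \<theta> - M \<theta> - W \<theta>)" if "\<theta> \<in> \<Theta>" for x \<theta>
    using that by (simp add: F_def w_def exp_add[symmetric])
  have F_out: "F x \<theta> = 0" if "\<theta> \<notin> \<Theta>" for x \<theta>
    using that by (simp add: F_def w_def)
  have F2: "integrable lborel (\<lambda>\<theta>. (norm \<theta>)\<^sup>2 * F x \<theta>)" if x: "x \<in> X" for x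
  proof -
    have "(\<integral>\<^sup>+\<theta>. ennreal ((norm \<theta>)\<^sup>2 * F x \<theta>) \<partial>lborel)
      = (\<integral>\<^sup>+ \<theta>\<in>\<Theta>. ennreal ((norm \<theta>)\<^sup>2 * exp (T x \<bullet> \<theta> - M \<theta> - W \<theta>)) \<partial>lborel)"
      by (intro nn_integral_cong) (auto simp: F_in F_out indicator_def)
    then show ?thesis using moment[OF x] F_nn by (intro integrableI_nonneg) auto
  qed
  \<comment> \<open>Off the unit ball \<open>(norm \<theta>)\<^sup>2 \<ge> 1\<close>, so the moment condition applies; on the ball the tangent of \<open>U\<close> at a point of \<open>\<Theta>\<close> bounds the density.\<close>
  have F1: "integrable lborel (F x)" if x: "x \<in> X" for x
  proof -
    obtain \<theta>0 where \<theta>0: "\<theta>0 \<in> \<Theta>" using regular by auto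
    obtain B where B: "B \<ge> 0" "\<And>v. norm (G \<theta>0 v) \<le> norm v * B"
      using bounded_linear.nonneg_bounded[OF has_derivative_bounded_linear[OF twice_differentiable_onD(1)[OF G \<theta>0]]]
      by blast
    define K where "K = norm (T x) - U \<theta>0 + (1 + norm \<theta>0) * B"
    have bound: "F x \<theta> \<le> exp K" if \<theta>: "norm \<theta> \<le> 1" for \<theta>
    proof (cases "\<theta> \<in> \<Theta>")
      case True
      have "norm (\<theta> - \<theta>0) \<le> 1 + norm \<theta>0" using norm_triangle_ineq4[of \<theta> \<theta>0] \<theta> by simp
      then have "norm (\<theta> - \<theta>0) * B \<le> (1 + norm \<theta>0) * B" using B by (intro mult_right_mono)
      then have "- ((1 + norm \<theta>0) * B) \<le> G \<theta>0 (\<theta> - \<theta>0)"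
        using B(2)[of "\<theta> - \<theta>0"] by (simp add: abs_le_iff)
      then have "U \<theta>0 - (1 + norm \<theta>0) * B \<le> U \<theta>"
        using tangent[OF \<theta>0 True] by simp
      moreover have "T x \<bullet> \<theta> \<le> norm (T x)"
        using norm_cauchy_schwarz[of "T x" \<theta>] mult_left_mono[OF \<theta>, of "norm (T x)"] by simp
      ultimately show ?thesis by (simp add: F_in[OF True] K_def U_def)
    qed (simp add: F_out)
    show ?thesis
    proof (rule Bochner_Integration.integrable_bound)
      show "integrable lborel (\<lambda>\<theta>. (norm \<theta>)\<^sup>2 * F x \<theta> + exp K * indicator (cball 0 1) \<theta>)"
        using F2[OF x] emeasure_lborel_cball_finite[of "0 :: real ^ 'd" 1]
        by (intro Bochner_Integration.integrable_add integrable_mult_right integrable_real_indicator)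
          auto
      show "AE \<theta> in lborel. norm (F x \<theta>) \<le> norm ((norm \<theta>)\<^sup>2 * F x \<theta> + exp K * indicator (cball 0 1) \<theta>)"
      proof (rule AE_I2)
        fix \<theta>
        have "F x \<theta> \<le> (norm \<theta>)\<^sup>2 * F x \<theta> + exp K * indicator (cball 0 1) \<theta>"
        proof (cases "norm \<theta> \<le> 1")
          case True
          then show ?thesis using bound[OF True] F_nn[of x \<theta>] by (simp add: add_increasing)
        next
          case False
          then have "1 \<le> (norm \<theta>)\<^sup>2" by (simp add: one_le_power)
          then show ?thesis using mult_right_mono[of 1 "(norm \<theta>)\<^sup>2" "F x \<theta>"] F_nn[of x \<theta>] False by simp
        qed
        then show "norm (F x \<theta>) \<le> norm ((norm \<theta>)\<^sup>2 * F x \<theta> + exp K * indicator (cball 0 1) \<theta>)"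
          using F_nn[of x \<theta>] by simp
      qed
    qed measurable
  qed
  define Z where "Z = (\<lambda>x. \<integral>\<theta>. F x \<theta> \<partial>lborel)"
  have Z: "Z x > 0" if x: "x \<in> X" for x
  proof -
    have "Z x \<noteq> 0"
    proof
      assume "Z x = 0"
      then have "AE \<theta> in lborel. F x \<theta> = 0"
        unfolding Z_def by (subst (asm) integral_nonneg_eq_0_iff_AE[OF F1[OF x]]) (auto simp: F_nn)
      then have "AE \<theta> in lborel. \<theta> \<notin> \<Theta>" by eventually_elim (auto simp: F_in)
      then have "emeasure lborel \<Theta> = 0" by (subst (asm) AE_iff_measurable[of \<Theta>]) auto
      then show False using emeasure_lborel_open_pos regular by blast
    qed
    moreover have "Z x \<ge> 0" unfolding Z_def by (intro integral_nonneg_AE AE_I2 F_nn)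
    ultimately show ?thesis by simp
  qed
  have posterior: "posterior \<pi> T M x = density lborel (\<lambda>\<theta>. ennreal (F x \<theta> / Z x))" if x: "x \<in> X" for x
  proof -
    have "(\<integral>\<^sup>+\<tau>. ennreal (exp (T x \<bullet> \<tau> - M \<tau>)) \<partial>\<pi>) = (\<integral>\<^sup>+\<tau>. ennreal (F x \<tau>) \<partial>lborel)"
      unfolding \<pi>_eq F_def by (subst nn_integral_density) (auto simp: ennreal_mult w_nn)
    also have "\<dots> = ennreal (Z x)"
      unfolding Z_def using F1[OF x] F_nn by (intro nn_integral_eq_integral) auto
    finally have "posterior \<pi> T M x = density \<pi> (\<lambda>\<theta>. ennreal (exp (T x \<bullet> \<theta> - M \<theta>)) / ennreal (Z x))"
      unfolding posterior_def by simp
    also have "\<dots> = density lborel (\<lambda>\<theta>. ennreal (w \<theta>) * (ennreal (exp (T x \<bullet> \<theta> - M \<theta>)) / ennreal (Z x)))"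
      unfolding \<pi>_eq by (rule density_density_eq) measurable
    also have "\<dots> = density lborel (\<lambda>\<theta>. ennreal (F x \<theta> / Z x))"
      using Z[OF x] by (intro arg_cong[where f = "density lborel"])
        (auto simp: F_def w_nn fun_eq_iff divide_ennreal simp flip: ennreal_mult)
    finally show ?thesis .
  qed
  define V where "V = (\<lambda>\<theta>. M \<theta> + W \<theta> - T x1 \<bullet> \<theta>)"
  define p where "p = T x2 - T x1"
  have F_x1: "F x1 = (\<lambda>\<theta>. indicator \<Theta> \<theta> * exp (- V \<theta>))"
  proof
    show "F x1 \<theta> = indicator \<Theta> \<theta> * exp (- V \<theta>)" for \<theta>
      by (cases "\<theta> \<in> \<Theta>") (auto simp: F_in F_out V_def algebra_simps)
  qed
  have F_x2: "F x2 = (\<lambda>\<theta>. indicator \<Theta> \<theta> * exp (- V \<theta> + p \<bullet> \<theta>))"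
  proof
    show "F x2 \<theta> = indicator \<Theta> \<theta> * exp (- V \<theta> + p \<bullet> \<theta>)" for \<theta>
      by (cases "\<theta> \<in> \<Theta>") (auto simp: F_in F_out V_def p_def inner_diff_left algebra_simps)
  qed
  have "wasserstein2 (density lborel (\<lambda>\<theta>. ennreal (F x1 \<theta> / Z x1))) (density lborel (\<lambda>\<theta>. ennreal (F x2 \<theta> / Z x2)))
     \<le> ennreal (norm p / \<alpha>)"
    unfolding Z_def F_x1 F_x2
  proof (rule wasserstein2_linear_tilt_le[OF \<alpha> conv])
    show "V ((1 - t) *\<^sub>R x + t *\<^sub>R y) \<le> (1 - t) * V x + t * V y - \<alpha> / 2 * t * (1 - t) * (norm (x - y))\<^sup>2"
      if "x \<in> \<Theta>" "y \<in> \<Theta>" "0 < t" "t < 1" for x y t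
      using strong[OF that] by (simp add: V_def U_def inner_add_right algebra_simps)
  qed (rule F1[OF x12(1), unfolded F_x1] F2[OF x12(1), unfolded F_x1] Z[OF x12(1), unfolded Z_def F_x1]
        F1[OF x12(2), unfolded F_x2] F2[OF x12(2), unfolded F_x2] Z[OF x12(2), unfolded Z_def F_x2])+
  also have "norm p \<le> Lip X T * norm (x1 - x2)"
    using dist_le_Lip[OF T x12] by (simp add: p_def dist_norm norm_minus_commute)
  then have "ennreal (norm p / \<alpha>) \<le> ennreal (Lip X T / \<alpha> * norm (x1 - x2))"
    using \<alpha> by (intro ennreal_leI) (simp add: field_simps)
  finally show "wasserstein2 (posterior \<pi> T M x1) (posterior \<pi> T M x2)
      \<le> ennreal (Lip X T / \<alpha> * norm (x1 - x2))"
    using posterior x12 by simp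
qed

end
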